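(* Let $t$ be an integer with $m=2t+1\geq 11$, $n=2^m+1$, and $\delta_1=\frac{n}{3}$, $\delta_2=\frac{n-3}{6}$, $\delta_3=\delta_2-2$, $\delta_4=\delta_2-8$, $\delta_5=\delta_2-10$. Let $\delta$ be an odd integer. Then: (1) the narrow-sense BCH code $\mathcal{C}(n,2,\delta,1)$ has parameters $[n,\ n-m\delta+5m,\ d\geq\delta]$ if $2^{t+1}+3\leq\delta\leq 2^{t+1}+2^t-3$; $[n,\ n-m\delta+9m,\ d\geq\delta]$ if $2^{t+1}+2^t+3\leq\delta\leq 2^{t+2}-9$; $[n,\ n-2^{t+2}m+16m,\ d\geq 2^{t+2}+9]$ if $2^{t+2}-7\leq\delta\leq 2^{t+2}+9$; $[n,\ 2m(i-1)+3,\ d\geq\delta_i]$ if $\delta_{i+1}+2\leq\delta\leq\delta_i$ for some $i\in\{1,2,3,4\}$; $[n,1,n]$ if $\delta_1+2\leq\delta\leq n$. (2) the BCH code $\mathcal{C}(n,2,\delta+1,0)$ has parameters $[n,\ 2^m-m\delta+5m,\ d\geq2\delta]$ if $2^{t+1}+3\leq\delta\leq 2^{t+1}+2^t-3$; $[n,\ 2^m-m\delta+9m,\ d\geq2\delta]$ if $2^{t+1}+2^t+3\leq\delta\leq 2^{t+2}-9$; $[n,\ 2^m-2^{t+2}m+16m,\ d\geq 2(2^{t+2}+9)]$ if $2^{t+2}-7\leq\delta\leq 2^{t+2}+9$; $[n,\ 2m(i-1)+2,\ d\geq2\delta_i]$ if $\delta_{i+1}+2\leq\delta\leq\delta_i$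 for some $i\in\{1,2,3,4\}$.
   Context: For $n=2^m+1$ and an integer $x$, the 2-cyclotomic coset of $x$ modulo $n$ is $C_x=\{x\cdot 2^{j} \bmod n : j\geq 0\}\subseteq\{0,1,\dots,n-1\}$. Let $\xi$ be a primitive $n$-th root of unity in an extension field of $\mathbb{F}_2$. A binary cyclic code of length $n$ with generator polynomial $g(x)$ has defining set $\{i\in\{0,\dots,n-1\}: g(\xi^i)=0\}$ (a union of cosets $C_x$), and its dimension is $n$ minus the size of the defining set. $\mathcal{C}(n,2,\delta,1)$ denotes the binary cyclic code of length $n$ with defining set $C_1\cup C_2\cup\cdots\cup C_{\delta-1}$, and $\mathcal{C}(n,2,\delta+1,0)$ the one with defining set $C_0\cup C_1\cup\cdots\cup C_{\delta-1}$. $[n,k,d]$ denotes a linear code of length $n$, dimension $k$, minimum Hamming distance $d$. *)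

theory Defs
  imports Main
begin

definition cyc_coset :: "nat \<Rightarrow> nat \<Rightarrow> nat set" where
  "cyc_coset n x = {(x * 2 ^ j) mod n | j. True}"

text \<open>Binary words of length n are represented as c :: nat \<Rightarrow> bool with c i = False for i \<ge> n
  (c i = True means the i-th coordinate is 1).  The binary cyclic code of length n with
  defining set T w.r.t. the primitive n-th root of unity xi consists of the words c whose
  associated polynomial c(x) = sum c_i x^i vanishes at xi^j for all j in T.\<close>
definition cyclic_code :: "nat \<Rightarrow> 'a::field \<Rightarrow> nat set \<Rightarrow> (nat \<Rightarrow> bool) set" where
  "cyclic_code n xi T =
     {c. (\<forall>i. n \<le> i \<longrightarrow> \<not> c i) \<and>
         (\<forall>j\<in>T. (\<Sum>i<n. if c i then xi ^ (i * j) else 0) = 0)}"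

definition bch_code :: "nat \<Rightarrow> 'a::field \<Rightarrow> nat \<Rightarrow> nat \<Rightarrow> (nat \<Rightarrow> bool) set" where
  "bch_code n xi delta b = cyclic_code n xi (\<Union>x\<in>{b..<b + delta - 1}. cyc_coset n x)"

definition hweight :: "(nat \<Rightarrow> bool) \<Rightarrow> nat" where
  "hweight c = card {i. c i}"

text \<open>Dimension: a binary linear code C has dimension k iff it has 2^k codewords.\<close>
definition code_dim :: "(nat \<Rightarrow> bool) set \<Rightarrow> nat \<Rightarrow> bool" where
  "code_dim C k \<longleftrightarrow> card C = 2 ^ k"

text \<open>Minimum Hamming distance = minimum weight of a nonzero codeword (linear code).\<close>
definition min_dist :: "(nat \<Rightarrow> bool) set \<Rightarrow> nat" where
  "min_dist C = Min (hweight ` (C - {\<lambda>_. False}))"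

definition prim_root :: "nat \<Rightarrow> 'a::field \<Rightarrow> bool" where
  "prim_root n xi \<longleftrightarrow> xi ^ n = 1 \<and> (\<forall>k. 0 < k \<and> k < n \<longrightarrow> xi ^ k \<noteq> 1)"

end

theory Submission
  imports Defs "HOL-Computational_Algebra.Polynomial" "HOL-Number_Theory.Cong"
begin

text \<open>The dimension of a binary cyclic code is \<open>n\<close> minus the size of its defining set \<open>T\<close>: the
  discrete Fourier transform of a binary word satisfies \<open>A (2 * j) = (A j)\<^sup>2\<close>, so at most \<open>2 ^ |S|\<close>
  functions can occur as its restriction to a union \<open>S\<close> of cosets, and using this both for \<open>T\<close>
  and for its complement pins the number of codewords down.

  The rest is the arithmetic of cosets modulo \<open>n = 2 ^ m + 1\<close>. Since \<open>2 ^ m\<close> is \<open>-1\<close>, cosets are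
  closed under negation and two elements \<open>x\<close>, \<open>y\<close> are equivalent iff \<open>x * 2 ^ j = \<plusminus> y\<close> for some
  \<open>j < m\<close>. For small \<open>x\<close> and \<open>y\<close> one may swap them to get \<open>j \<le> t\<close>, and then all coincidences can
  be listed. At the other end, doubling moves points with \<open>|x| > n / 6\<close> alternately into and out of
  the middle third, which is incompatible with \<open>m\<close> being odd; hence apart from \<open>n / 3\<close> all leaders
  are at most \<open>(n - 3) / 6\<close>, and the last few are found by direct computation.\<close>

section \<open>Binary cyclic codes and their spectra\<close>

text \<open>This is the discrete Fourier transform of the word \<open>c\<close>.\<close>

definition spectrum :: "nat \<Rightarrow> 'a::field \<Rightarrow> (nat \<Rightarrow> bool) \<Rightarrow> nat \<Rightarrow> 'a" where
  "spectrum n xi c j = (\<Sum>i<n. if c i then xi ^ (i * j) else 0)"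

definition words :: "nat \<Rightarrow> (nat \<Rightarrow> bool) set" where
  "words n = {c. \<forall>i. n \<le> i \<longrightarrow> \<not> c i}"

text \<open>These are the unions of 2-cyclotomic cosets modulo \<open>n\<close>, phrased through a
  single doubling step.\<close>

definition doubling_closed :: "nat \<Rightarrow> nat set \<Rightarrow> bool" where
  "doubling_closed n T \<longleftrightarrow> T \<subseteq> {..<n} \<and> (\<forall>j\<in>T. 2 * j mod n \<in> T)"

text \<open>The conjugacy constraint is the one satisfied by spectra of binary words. Fixing the
  value 0 outside \<open>T\<close> makes each function determined by its restriction to
  \<open>T\<close>, so that the set can be counted.\<close>

definition conj_spectra :: "nat \<Rightarrow> nat set \<Rightarrow> (nat \<Rightarrow> 'a::field) set" where
  "conj_spectra n T = {A. (\<forall>j. j \<notin> T \<longrightarrow> A j = 0) \<and> (\<forall>j\<in>T. A (2 * j mod n) = (A j)\<^sup>2)}"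

lemma cyclic_code_altdef:
  "cyclic_code n xi T = {c \<in> words n. \<forall>j\<in>T. spectrum n xi c j = 0}"
  by (auto simp: cyclic_code_def words_def spectrum_def)

lemma words_eq_image: "words n = (\<lambda>S i. i \<in> S) ` Pow {..<n}"
proof
  show "words n \<subseteq> (\<lambda>S i. i \<in> S) ` Pow {..<n}"
  proof
    fix c assume "c \<in> words n"
    hence "Collect c \<in> Pow {..<n}" by (auto simp: words_def not_le[symmetric])
    moreover have "c = (\<lambda>i. i \<in> Collect c)" by simp
    ultimately show "c \<in> (\<lambda>S i. i \<in> S) ` Pow {..<n}" by (rule rev_image_eqI)
  qed
qed (auto simp: words_def)

lemma finite_words: "finite (words n)"
  by (simp add: words_eq_image)

lemma card_words: "card (words n) = 2 ^ n"
proof -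
  have "inj_on (\<lambda>S i. i \<in> S) (Pow {..<n})"
    by (rule inj_onI) (metis Collect_mem_eq)
  thus ?thesis by (simp add: words_eq_image card_image card_Pow)
qed

lemma xi_pow_mod:
  fixes xi :: "'a::field"
  assumes "xi ^ n = 1"
  shows "xi ^ (k mod n) = xi ^ k"
proof -
  have "xi ^ k = xi ^ (n * (k div n) + k mod n)" by simp
  also have "\<dots> = xi ^ (k mod n)" by (simp only: power_add power_mult assms) simp
  finally show ?thesis by simp
qed

lemma spectrum_mod:
  assumes "xi ^ n = 1"
  shows "spectrum n xi c (j mod n) = spectrum n xi c j"
proof -
  have "xi ^ (i * (j mod n)) = xi ^ (i * j)" for i
    by (metis xi_pow_mod[OF assms] mod_mult_right_eq)
  thus ?thesis by (simp add: spectrum_def cong: if_cong)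
qed

lemma char2_add_self:
  fixes x :: "'a::field"
  assumes "(2::'a) = 0"
  shows "x + x = 0"
  by (metis assms mult_2 mult_zero_left)

lemma char2_sum_square:
  fixes f :: "'b \<Rightarrow> 'a::field"
  assumes "(2::'a) = 0" and "finite A"
  shows "(\<Sum>i\<in>A. f i)\<^sup>2 = (\<Sum>i\<in>A. (f i)\<^sup>2)"
  using assms(2) by induction (auto simp: power2_sum assms(1))

text \<open>Squaring is additive in characteristic 2 and fixes the coefficients 0 and 1, so it only
  doubles the exponents.\<close>

lemma spectrum_double:
  fixes xi :: "'a::field"
  assumes "(2::'a) = 0" and "xi ^ n = 1"
  shows "spectrum n xi c (2 * j mod n) = (spectrum n xi c j)\<^sup>2"
proof -
  have "(spectrum n xi c j)\<^sup>2 = (\<Sum>i<n. (if c i then xi ^ (i * j) else 0)\<^sup>2)"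
    by (simp add: spectrum_def char2_sum_square assms(1))
  also have "\<dots> = spectrum n xi c (2 * j)"
    unfolding spectrum_def by (rule sum.cong) (auto simp: power_mult[symmetric] mult_ac)
  finally show ?thesis by (simp add: spectrum_mod assms(2))
qed

text \<open>Inequality of truth values is addition in the binary field; positions where both words
  are 1 cancel because \<open>1 + 1 = 0\<close>.\<close>

lemma spectrum_xor:
  fixes xi :: "'a::field"
  assumes "(2::'a) = 0"
  shows "spectrum n xi (\<lambda>i. c i \<noteq> d i) j = spectrum n xi c j + spectrum n xi d j"
  unfolding spectrum_def sum.distrib[symmetric]
  by (rule sum.cong) (auto simp: char2_add_self assms)

lemma prim_root_inj:
  assumes "prim_root n xi" and "i < n" and "k < n" and "xi ^ i = xi ^ k"
  shows "i = k"
proof -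
  have xi0: "xi \<noteq> 0" using assms(1,2) by (auto simp: prim_root_def power_0_left split: if_splits)
  have "a = b" if "a \<le> b" "b < n" "xi ^ a = xi ^ b" for a b
  proof -
    have "xi ^ b = xi ^ a * xi ^ (b - a)" using that(1) by (simp add: power_add[symmetric])
    with that(3) xi0 have "xi ^ (b - a) = 1" by simp
    with assms(1) that show ?thesis unfolding prim_root_def
      by (metis diff_is_0_eq' diff_le_self le_antisym le_less_trans not_gr_zero diff_is_0_eq)
  qed
  thus ?thesis using assms(2-4) by (metis nat_le_linear)
qed

text \<open>Pair the power sums over the support with the polynomial that vanishes at all
  but one of the locators.\<close>
lemma bch_bound:
  assumes xi: "prim_root n xi" and c: "c \<in> words n" "c \<noteq> (\<lambda>_. False)"
    and zeros: "\<And>j. j < d \<Longrightarrow> spectrum n xi c (b + j) = 0"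
  shows "d < hweight c"
proof (rule ccontr)
  assume "\<not> d < hweight c"
  define S where "S = {i. c i}"
  have le: "card S \<le> d" using \<open>\<not> d < hweight c\<close> by (simp add: hweight_def S_def)
  have Sn: "S \<subseteq> {..<n}" using c(1) by (auto simp: S_def words_def not_le[symmetric])
  hence fin: "finite S" by (rule finite_subset) simp
  obtain i0 where i0: "i0 \<in> S" using c(2) by (auto simp: S_def fun_eq_iff)
  have spec: "spectrum n xi c j = (\<Sum>i\<in>S. xi ^ (i * j))" for j
    unfolding spectrum_def sum.inter_filter[OF finite_lessThan, symmetric]
    by (rule sum.cong) (use Sn in \<open>auto simp: S_def\<close>)
  define f where "f = (\<Prod>i\<in>S - {i0}. [:- (xi ^ i), 1:])"
  have "degree f \<le> (\<Sum>i\<in>S - {i0}. degree [:- (xi ^ i), 1:])"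
    unfolding f_def by (rule degree_prod_sum_le[unfolded o_def]) (simp add: fin)
  also have "\<dots> = card S - 1" using i0 fin by simp
  finally have deg: "degree f < d"
    using le i0 fin by (metis One_nat_def Suc_pred card_gt_0_iff empty_iff less_Suc_eq_le le_less_trans order_less_le_trans diff_less zero_less_one)
  have "(\<Sum>i\<in>S. xi ^ (i * b) * poly f (xi ^ i))
      = (\<Sum>i\<in>S. \<Sum>k\<le>degree f. coeff f k * xi ^ (i * (b + k)))"
    by (simp add: poly_altdef sum_distrib_left power_add power_mult distrib_left mult_ac)
  also have "\<dots> = (\<Sum>k\<le>degree f. coeff f k * spectrum n xi c (b + k))"
    by (subst sum.swap) (simp add: spec sum_distrib_left)
  also have "\<dots> = 0"
    by (rule sum.neutral) (use deg zeros in auto)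
  finally have sum0: "(\<Sum>i\<in>S. xi ^ (i * b) * poly f (xi ^ i)) = 0" .
  have "poly f (xi ^ i) = 0" if "i \<in> S - {i0}" for i
    unfolding f_def poly_prod using that fin by (intro prod_zero) auto
  hence "(\<Sum>i\<in>S. xi ^ (i * b) * poly f (xi ^ i)) = xi ^ (i0 * b) * poly f (xi ^ i0)"
    using fin i0 by (subst sum.remove[of _ i0]) (auto intro!: sum.neutral)
  with sum0 have "xi ^ (i0 * b) * poly f (xi ^ i0) = 0" by simp
  moreover have "xi \<noteq> 0" using xi i0 Sn by (auto simp: prim_root_def power_0_left split: if_splits)
  ultimately have "poly f (xi ^ i0) = 0" by simp
  then obtain i where "i \<in> S - {i0}" "xi ^ i0 = xi ^ i"
    unfolding f_def poly_prod using fin by auto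
  thus False using prim_root_inj[OF xi] Sn i0 by (metis Diff_iff insert_iff lessThan_iff subsetD)
qed

text \<open>Injectivity of the Fourier transform follows from the BCH bound: a nonzero difference
  with \<open>n\<close> consecutive zeros would have weight above \<open>n\<close>.\<close>

lemma spectrum_inj:
  fixes xi :: "'a::field"
  assumes "(2::'a) = 0" and "prim_root n xi" and "c \<in> words n" and "d \<in> words n"
    and "\<And>j. j < n \<Longrightarrow> spectrum n xi c j = spectrum n xi d j"
  shows "c = d"
proof (rule ccontr)
  assume "c \<noteq> d"
  define e where "e = (\<lambda>i. c i \<noteq> d i)"
  have e: "e \<in> words n" using assms(3,4) by (auto simp: e_def words_def)
  have "e \<noteq> (\<lambda>_. False)" using \<open>c \<noteq> d\<close> by (auto simp: e_def fun_eq_iff)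
  moreover have "spectrum n xi e (0 + j) = 0" if "j < n" for j
    unfolding e_def add_0 spectrum_xor[OF assms(1)] assms(5)[OF that] by (rule char2_add_self[OF assms(1)])
  ultimately have "n < hweight e" using bch_bound[OF assms(2) e] by blast
  moreover have "hweight e \<le> card {..<n}" unfolding hweight_def
    by (rule card_mono) (use e in \<open>auto simp: words_def not_le[symmetric]\<close>)
  ultimately show False by simp
qed

section \<open>Counting conjugate-symmetric functions and codewords\<close>

text \<open>The fixed points are the roots of \<open>X ^ (2 ^ s) - X\<close>, which is nonzero
  because \<open>0 < s\<close> keeps its two terms apart. This bounds the possible values of a
  spectrum at a point that returns to itself after \<open>s\<close> doublings.\<close>

lemma card_frobenius_fixed:
  assumes "0 < s"
  shows "finite {a::'a::field. a ^ (2 ^ s) = a}" and "card {a::'a. a ^ (2 ^ s) = a} \<le> 2 ^ s"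
proof -
  define p :: "'a poly" where "p = monom 1 (2 ^ s) - [:0, 1:]"
  have s: "(1::nat) < 2 ^ s" by (rule one_less_power) (use assms in auto)
  have co: "coeff p (2 ^ s) = 1" using s assms by (simp add: p_def coeff_pCons split: nat.split)
  hence p0: "p \<noteq> 0" by auto
  have "degree p \<le> 2 ^ s" unfolding p_def
    by (rule degree_diff_le) (use s in \<open>auto simp: degree_monom_le\<close>)
  moreover have eq: "{a::'a. a ^ (2 ^ s) = a} = {a. poly p a = 0}"
    by (auto simp: p_def poly_monom)
  ultimately show "card {a::'a. a ^ (2 ^ s) = a} \<le> 2 ^ s"
    using card_poly_roots_bound[OF p0] by simp
  show "finite {a::'a::field. a ^ (2 ^ s) = a}"
    unfolding eq using poly_roots_finite[OF p0] .
qed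

lemma double_mod_cancel:
  fixes x y n :: nat
  assumes "odd n" and "[2 ^ k * x = 2 ^ k * y] (mod n)"
  shows "[x = y] (mod n)"
  using assms by (metis cong_mult_lcancel_nat coprime_left_2_iff_odd coprime_power_left_iff)

text \<open>Pigeonhole on one power more than the coset has elements, followed by cancelling the
  common power of two. That the period is at most the coset size is what the counting bound below
  needs.\<close>

lemma cyc_coset_period:
  assumes "odd n" and "x < n"
  obtains s where "0 < s" "s \<le> card (cyc_coset n x)" "x * 2 ^ s mod n = x"
proof -
  define f where "f = (\<lambda>j. x * 2 ^ j mod n)"
  have sub: "f ` {..card (cyc_coset n x)} \<subseteq> cyc_coset n x" by (auto simp: f_def cyc_coset_def)
  have "cyc_coset n x \<subseteq> {..<n}" using assms(2) by (auto simp: cyc_coset_def)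
  hence "finite (cyc_coset n x)" by (rule finite_subset) simp
  hence "card (f ` {..card (cyc_coset n x)}) \<le> card (cyc_coset n x)"
    using sub by (rule card_mono)
  hence "\<not> inj_on f {..card (cyc_coset n x)}"
    by (metis card_atMost card_image not_less_eq_eq order_refl)
  then obtain a b where ab: "a < b" "b \<le> card (cyc_coset n x)" "f a = f b"
    unfolding inj_on_def by (metis atMost_iff linorder_neqE_nat)
  have "[2 ^ a * (x * 2 ^ (b - a)) = 2 ^ a * x] (mod n)"
    using ab by (simp add: f_def cong_def mult_ac power_add[symmetric])
  hence "[x * 2 ^ (b - a) = x] (mod n)" by (rule double_mod_cancel[OF assms(1)])
  hence "x * 2 ^ (b - a) mod n = x" using assms(2) by (simp add: cong_def)
  thus ?thesis using ab by (intro that[of "b - a"]) auto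
qed

lemma doubling_closed_power:
  assumes "doubling_closed n T" and "x \<in> T"
  shows "x * 2 ^ j mod n \<in> T"
proof (induction j)
  case 0
  show ?case using assms by (auto simp: doubling_closed_def)
next
  case (Suc j)
  hence "2 * (x * 2 ^ j mod n) mod n \<in> T" using assms(1) by (simp add: doubling_closed_def)
  thus ?case by (simp add: mod_mult_right_eq mult_ac)
qed

lemma conj_spectra_power:
  assumes "doubling_closed n T" and "x \<in> T" and "A \<in> conj_spectra n T"
  shows "A (x * 2 ^ j mod n) = A x ^ (2 ^ j)"
proof (induction j)
  case 0
  show ?case using assms by (auto simp: doubling_closed_def)
next
  case (Suc j)
  have "A (2 * (x * 2 ^ j mod n) mod n) = (A (x * 2 ^ j mod n))\<^sup>2"
    using assms(3) doubling_closed_power[OF assms(1,2)] by (simp add: conj_spectra_def)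
  thus ?case by (simp add: mod_mult_right_eq mult_ac Suc power_mult[symmetric])
qed

text \<open>Doubling is invertible on residues modulo an odd number: if \<open>j\<close> has period
  \<open>s\<close>, then \<open>s - 1\<close> further doublings lead from \<open>2 * j\<close> back
  to \<open>j\<close>.\<close>

lemma doubling_closed_Diff:
  assumes "odd n" and "doubling_closed n T" and "doubling_closed n S"
  shows "doubling_closed n (T - S)"
  unfolding doubling_closed_def
proof safe
  fix j assume "j \<in> T"
  thus "j < n" using assms(2) by (auto simp: doubling_closed_def)
next
  fix j assume j: "j \<in> T" "j \<notin> S"
  thus "2 * j mod n \<in> T" using assms(2) by (auto simp: doubling_closed_def)
  have "j < n" using j(1) assms(2) by (auto simp: doubling_closed_def)
  then obtain s where s: "0 < s" "j * 2 ^ s mod n = j" using cyc_coset_period[OF assms(1)] by metis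
  assume "2 * j mod n \<in> S"
  hence "(2 * j mod n) * 2 ^ (s - 1) mod n \<in> S" by (rule doubling_closed_power[OF assms(3)])
  also have "(2 * j mod n) * 2 ^ (s - 1) mod n = j * (2 * 2 ^ (s - 1)) mod n"
    by (simp add: mod_mult_left_eq mult_ac)
  also have "\<dots> = j" using s by (simp add: power_eq_if[of 2 s])
  finally show False using j(2) by simp
qed

lemma doubling_closed_cyc_coset:
  assumes "0 < n"
  shows "doubling_closed n (cyc_coset n x)"
  unfolding doubling_closed_def
proof (intro conjI ballI)
  show "cyc_coset n x \<subseteq> {..<n}" using assms by (auto simp: cyc_coset_def)
  fix y assume "y \<in> cyc_coset n x"
  then obtain j where "y = x * 2 ^ j mod n" by (auto simp: cyc_coset_def)
  hence "2 * y mod n = x * 2 ^ Suc j mod n" by (simp add: mod_mult_right_eq mult_ac)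
  thus "2 * y mod n \<in> cyc_coset n x" unfolding cyc_coset_def by blast
qed

text \<open>One coset \<open>Q\<close> is split off at a time. On \<open>Q\<close> a function is
  determined by its value at \<open>x\<close>, which is fixed by the \<open>s\<close>-fold Frobenius
  map with \<open>s \<le> card Q\<close>; the rest is handled by induction.\<close>

lemma conj_spectra_card_le:
  assumes "odd n" and "doubling_closed n T"
  shows "finite (conj_spectra n T :: (nat \<Rightarrow> 'a::field) set) \<and>
         card (conj_spectra n T :: (nat \<Rightarrow> 'a) set) \<le> 2 ^ card T"
  using assms(2)
proof (induction "card T" arbitrary: T rule: less_induct)
  case less
  note cl = less.prems
  have Tn: "T \<subseteq> {..<n}" using cl by (simp add: doubling_closed_def)
  hence finT: "finite T" by (rule finite_subset) simp
  show ?case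
  proof (cases "T = {}")
    case True
    hence "(conj_spectra n T :: (nat \<Rightarrow> 'a) set) = {\<lambda>_. 0}" by (auto simp: conj_spectra_def)
    thus ?thesis using True by simp
  next
    case False
    then obtain x where x: "x \<in> T" by blast
    hence xn: "x < n" using Tn by auto
    define Q where "Q = cyc_coset n x"
    have Q: "Q \<subseteq> T" using doubling_closed_power[OF cl x] by (auto simp: Q_def cyc_coset_def)
    have "x * 2 ^ 0 mod n \<in> Q" unfolding Q_def cyc_coset_def by blast
    hence xQ: "x \<in> Q" using xn by simp
    have clQ: "doubling_closed n Q" unfolding Q_def using xn by (intro doubling_closed_cyc_coset) auto
    have clD: "doubling_closed n (T - Q)" by (rule doubling_closed_Diff[OF assms(1) cl clQ])
    obtain s where s: "0 < s" "s \<le> card Q" "x * 2 ^ s mod n = x"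
      using cyc_coset_period[OF assms(1) xn] unfolding Q_def by blast
    have lt: "card (T - Q) < card T" using x xQ finT by (intro psubset_card_mono) auto
    let ?F = "{a::'a. a ^ (2 ^ s) = a}" and ?K = "conj_spectra n (T - Q) :: (nat \<Rightarrow> 'a) set"
    define g :: "(nat \<Rightarrow> 'a) \<Rightarrow> 'a \<times> (nat \<Rightarrow> 'a)"
      where "g = (\<lambda>A. (A x, \<lambda>j. if j \<in> T - Q then A j else 0))"
    have "g ` conj_spectra n T \<subseteq> ?F \<times> ?K"
    proof
      fix p assume "p \<in> g ` conj_spectra n T"
      then obtain A where A: "A \<in> conj_spectra n T" "p = g A" by blast
      have "A x ^ (2 ^ s) = A x" using conj_spectra_power[OF cl x A(1), of s] s(3) by simp
      moreover have "(\<lambda>j. if j \<in> T - Q then A j else 0) \<in> ?K"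
        using A(1) clD by (auto simp: conj_spectra_def doubling_closed_def)
      ultimately show "p \<in> ?F \<times> ?K" by (simp add: A(2) g_def)
    qed
    moreover have "inj_on g (conj_spectra n T)"
    proof (rule inj_onI, rule ext)
      fix A B j assume A: "A \<in> conj_spectra n T" and B: "B \<in> conj_spectra n T" and eq: "g A = g B"
      consider "j \<notin> T" | "j \<in> Q" | "j \<in> T - Q" by blast
      thus "A j = B j"
      proof cases
        case 1 thus ?thesis using A B by (simp add: conj_spectra_def)
      next
        case 2
        then obtain k where "j = x * 2 ^ k mod n" by (auto simp: Q_def cyc_coset_def)
        thus ?thesis using conj_spectra_power[OF cl x A] conj_spectra_power[OF cl x B] eq
          by (simp add: g_def)
      next
        case 3
        have "(\<lambda>j. if j \<in> T - Q then A j else 0) = (\<lambda>j. if j \<in> T - Q then B j else 0)"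
          using eq by (simp add: g_def)
        from fun_cong[OF this, of j] 3 show ?thesis by simp
      qed
    qed
    moreover have fK: "finite ?K" "card ?K \<le> 2 ^ card (T - Q)" using less.hyps[OF lt clD] by auto
    have fin: "finite (?F \<times> ?K)" using card_frobenius_fixed(1)[OF s(1)] fK(1) by blast
    ultimately have "finite (conj_spectra n T :: (nat \<Rightarrow> 'a) set)"
      and "card (conj_spectra n T :: (nat \<Rightarrow> 'a) set) \<le> card (?F \<times> ?K)"
      by (auto intro: inj_on_finite card_inj_on_le)
    moreover have "card (?F \<times> ?K) \<le> 2 ^ card Q * 2 ^ card (T - Q)"
    proof -
      have "card ?F \<le> 2 ^ card Q"
        by (rule order.trans[OF card_frobenius_fixed(2)[OF s(1)]]) (use s(2) in \<open>simp add: power_increasing\<close>)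
      thus ?thesis unfolding card_cartesian_product using fK(2) by (rule mult_le_mono)
    qed
    moreover have "card Q + card (T - Q) = card T"
      using Q finT by (metis card_Diff_subset card_mono finite_subset le_add_diff_inverse)
    ultimately show ?thesis by (simp add: power_add[symmetric])
  qed
qed

text \<open>Restricting spectra to the complement of T embeds the code into a set of size at
  most 2^(n - |T|); restricting them to T embeds the cosets of the code into a set of
  size at most 2^|T|.\<close>
lemma card_cyclic_code:
  fixes xi :: "'a::field"
  assumes char2: "(2::'a) = 0" and xi: "prim_root n xi" and "odd n" and cl: "doubling_closed n T"
  shows "card (cyclic_code n xi T) = 2 ^ (n - card T)"
proof -
  define C where "C = cyclic_code n xi T"
  have C: "C = {c \<in> words n. \<forall>j\<in>T. spectrum n xi c j = 0}" by (simp add: C_def cyclic_code_altdef)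
  have xin: "xi ^ n = 1" using xi by (simp add: prim_root_def)
  have Tn: "T \<subseteq> {..<n}" using cl by (simp add: doubling_closed_def)
  hence finT: "finite T" by (rule finite_subset) simp
  have Cw: "C \<subseteq> words n" by (auto simp: C)
  hence finC: "finite C" using finite_words finite_subset by blast
  define R where "R = (\<lambda>S c j. if j \<in> S then spectrum n xi c j else 0)"
  have R_in: "R S c \<in> conj_spectra n S" if "doubling_closed n S" for S c
    using that by (auto simp: R_def conj_spectra_def doubling_closed_def spectrum_double char2 xin)
  have clc: "doubling_closed n ({..<n} - T)"
    by (rule doubling_closed_Diff[OF \<open>odd n\<close> _ cl]) (use \<open>odd n\<close> in \<open>auto simp: doubling_closed_def odd_pos\<close>)
  have "inj_on (R ({..<n} - T)) C"
  proof (rule inj_onI)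
    fix c d assume cd: "c \<in> C" "d \<in> C" and eq: "R ({..<n} - T) c = R ({..<n} - T) d"
    have "spectrum n xi c j = spectrum n xi d j" if "j < n" for j
      using cd fun_cong[OF eq, of j] that by (cases "j \<in> T") (auto simp: C R_def)
    thus "c = d" using spectrum_inj[OF char2 xi] cd Cw by blast
  qed
  moreover have "R ({..<n} - T) ` C \<subseteq> conj_spectra n ({..<n} - T)" using R_in[OF clc] by blast
  ultimately have "card C \<le> card (conj_spectra n ({..<n} - T) :: (nat \<Rightarrow> 'a) set)"
    using conj_spectra_card_le[where 'a='a, OF \<open>odd n\<close> clc] by (intro card_inj_on_le) auto
  also have "\<dots> \<le> 2 ^ (n - card T)"
    using conj_spectra_card_le[where 'a='a, OF \<open>odd n\<close> clc] Tn finT by (simp add: card_Diff_subset)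
  finally have upper: "card C \<le> 2 ^ (n - card T)" .
  define F where "F = (\<lambda>A. {c \<in> words n. R T c = A})"
  have fibre: "card (F A) \<le> card C" for A
  proof (cases "F A = {}")
    case True
    show ?thesis unfolding True by simp
  next
    case False
    then obtain d where d: "d \<in> words n" "R T d = A" by (auto simp: F_def)
    \<comment> \<open>A nonempty fibre is a coset of the code: adding one of its members,
      \<open>d\<close>, maps it injectively into \<open>C\<close>.\<close>
    have "(\<lambda>c i. c i \<noteq> d i) ` F A \<subseteq> C"
    proof
      fix e assume "e \<in> (\<lambda>c i. c i \<noteq> d i) ` F A"
      then obtain c where c: "c \<in> words n" "R T c = A" and e: "e = (\<lambda>i. c i \<noteq> d i)"
        by (auto simp: F_def)
      have "spectrum n xi c j = spectrum n xi d j" if "j \<in> T" for j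
      proof -
        have "R T c j = R T d j" using c d by simp
        thus ?thesis using that by (simp add: R_def)
      qed
      hence "spectrum n xi e j = 0" if "j \<in> T" for j
        unfolding e spectrum_xor[OF char2] using that by (simp add: char2 char2_add_self)
      moreover have "e \<in> words n" using c d by (auto simp: e words_def)
      ultimately show "e \<in> C" by (simp add: C)
    qed
    moreover have "inj_on (\<lambda>c i. c i \<noteq> d i) (F A)" by (rule inj_onI) (auto simp: fun_eq_iff)
    ultimately show ?thesis using finC by (intro card_inj_on_le)
  qed
  have "words n = (\<Union>A\<in>R T ` words n. F A)" by (auto simp: F_def)
  hence "card (words n) \<le> (\<Sum>A\<in>R T ` words n. card (F A))"
    using card_UN_le[of "R T ` words n" F] finite_words by simp
  also have "\<dots> \<le> card (R T ` words n) * card C"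
    using sum_bounded_above[of "R T ` words n" "\<lambda>A. card (F A)" "card C"] fibre by simp
  also have "card (R T ` words n) \<le> card (conj_spectra n T :: (nat \<Rightarrow> 'a) set)"
    using conj_spectra_card_le[where 'a='a, OF \<open>odd n\<close> cl] R_in[OF cl] by (intro card_mono) auto
  also have "\<dots> \<le> 2 ^ card T" using conj_spectra_card_le[where 'a='a, OF \<open>odd n\<close> cl] by simp
  finally have "2 ^ n \<le> 2 ^ card T * card C" by (simp add: card_words)
  moreover have "(2::nat) ^ n = 2 ^ card T * 2 ^ (n - card T)"
  proof -
    have "card T \<le> n" using card_mono[OF _ Tn] by simp
    thus ?thesis by (simp add: power_add[symmetric])
  qed
  ultimately have "2 ^ (n - card T) \<le> card C" by simp
  with upper show ?thesis by (simp add: C_def)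
qed

section \<open>Cyclotomic cosets modulo $2^m+1$\<close>

text \<open>This is the defining set of the narrow-sense code; the second code has the additional
  zero 0.\<close>

definition bch_zeros :: "nat \<Rightarrow> nat \<Rightarrow> nat set" where
  "bch_zeros n \<delta> = (\<Union>x\<in>{1..<\<delta>}. cyc_coset n x)"

locale two_pow_plus_one =
  fixes m n :: nat
  assumes n_eq: "n = 2 ^ m + 1" and m_pos: "0 < m"
begin

lemma n_ge: "3 \<le> n"
  using self_le_ge2_pow[of 2 m] power_increasing[of 1 m "2::nat"] m_pos n_eq by simp

lemma odd_n: "odd n"
  using m_pos by (simp add: n_eq)

text \<open>Since \<open>2 ^ m\<close> is \<open>-1\<close> modulo \<open>n\<close>, division of
  \<open>k\<close> by \<open>m\<close> gives \<open>r\<close> as the remainder and \<open>e\<close>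
  as the sign \<open>(- 1) ^ (k div m)\<close>.\<close>

lemma pow_mod_cases:
  obtains r e where "r < m" and "e = 1 \<or> e = - 1"
    and "\<And>x :: int. int n dvd x * 2 ^ k - e * (x * 2 ^ r)"
proof -
  define r where "r = k mod m"
  define e :: int where "e = (- 1) ^ (k div m)"
  have "[(2::int) ^ m = - 1] (mod int n)" by (simp add: n_eq cong_iff_dvd_diff add.commute)
  hence "[((2::int) ^ m) ^ (k div m) = e] (mod int n)" unfolding e_def by (rule cong_pow)
  hence "[((2::int) ^ m) ^ (k div m) * 2 ^ r = e * 2 ^ r] (mod int n)" by (rule cong_scalar_right)
  moreover have "((2::int) ^ m) ^ (k div m) * 2 ^ r = 2 ^ k"
    by (simp add: r_def power_mult[symmetric] power_add[symmetric])
  ultimately have "int n dvd 2 ^ k - e * 2 ^ r" by (simp add: cong_iff_dvd_diff)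
  hence "int n dvd x * (2 ^ k - e * 2 ^ r)" for x by simp
  moreover have "e = 1 \<or> e = - 1" unfolding e_def by (simp add: minus_one_power_iff)
  moreover have "r < m" using m_pos by (simp add: r_def)
  ultimately show ?thesis by (intro that[of r e]) (auto simp: algebra_simps)
qed

lemma mem_cyc_coset_less: "y \<in> cyc_coset n x \<Longrightarrow> y < n"
  using n_ge by (auto simp: cyc_coset_def)

lemma mem_cyc_cosetI:
  assumes "y < n" and "int n dvd int x * 2 ^ j - int y"
  shows "y \<in> cyc_coset n x"
proof -
  have "[int (x * 2 ^ j) = int y] (mod int n)" using assms(2) by (simp add: cong_iff_dvd_diff)
  hence "[x * 2 ^ j = y] (mod n)" by (simp only: cong_int_iff)
  hence "y = x * 2 ^ j mod n" using assms(1) by (simp add: cong_def)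
  thus ?thesis by (auto simp: cyc_coset_def)
qed

text \<open>The sign is absorbed by \<open>m\<close> further doublings.\<close>

lemma mem_cyc_cosetI_neg:
  assumes "y < n" and "int n dvd int x * 2 ^ j + int y"
  shows "y \<in> cyc_coset n x"
proof (rule mem_cyc_cosetI[OF assms(1)])
  have "int x * 2 ^ (j + m) - int y = int x * 2 ^ j * int n - (int x * 2 ^ j + int y)"
    by (simp add: n_eq power_add algebra_simps)
  thus "int n dvd int x * 2 ^ (j + m) - int y" using assms(2) by (simp only:) (intro dvd_diff dvd_triv_right)
qed

text \<open>The exponent is reduced below \<open>m\<close> at the price of a sign. Here
  \<open>e = - 1\<close> means that \<open>y\<close> is congruent to \<open>x * 2 ^ j\<close>, and
  \<open>e = 1\<close> that it is congruent to the negative.\<close>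

lemma mem_cyc_cosetE:
  assumes "y \<in> cyc_coset n x"
  obtains j e where "j < m" and "e = 1 \<or> e = - 1" and "int n dvd int x * 2 ^ j + e * int y"
proof -
  obtain k where "y = x * 2 ^ k mod n" using assms by (auto simp: cyc_coset_def)
  hence "[x * 2 ^ k = y] (mod n)" by (simp add: cong_def)
  hence "[int (x * 2 ^ k) = int y] (mod int n)" by (simp only: cong_int_iff)
  hence 1: "int n dvd int x * 2 ^ k - int y" by (simp add: cong_iff_dvd_diff)
  obtain r e where re: "r < m" "e = 1 \<or> e = - 1"
    and 2: "int n dvd int x * 2 ^ k - e * (int x * 2 ^ r)" using pow_mod_cases by metis
  have "int n dvd (int x * 2 ^ k - int y) - (int x * 2 ^ k - e * (int x * 2 ^ r))"
    using 1 2 by (rule dvd_diff)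
  hence "int n dvd e * ((int x * 2 ^ k - int y) - (int x * 2 ^ k - e * (int x * 2 ^ r)))" by simp
  also have "e * ((int x * 2 ^ k - int y) - (int x * 2 ^ k - e * (int x * 2 ^ r)))
      = int x * 2 ^ r + (- e) * int y" using re(2) by auto
  finally show ?thesis using re by (intro that[of r "- e"]) auto
qed

lemma cyc_coset_self: "x < n \<Longrightarrow> x \<in> cyc_coset n x"
  by (rule mem_cyc_cosetI[of _ _ 0]) auto

lemma cyc_coset_trans:
  assumes "y \<in> cyc_coset n x" and "z \<in> cyc_coset n y"
  shows "z \<in> cyc_coset n x"
proof -
  obtain i j where "y = x * 2 ^ i mod n" "z = y * 2 ^ j mod n" using assms by (auto simp: cyc_coset_def)
  hence "z = x * 2 ^ (i + j) mod n" by (simp add: mod_mult_left_eq power_add mult.assoc)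
  thus ?thesis unfolding cyc_coset_def by blast
qed

lemma cyc_coset_sym:
  assumes "y \<in> cyc_coset n x" and "x < n"
  shows "x \<in> cyc_coset n y"
proof -
  obtain j e where j: "j < m" and e: "e = 1 \<or> e = - 1" and d: "int n dvd int x * 2 ^ j + e * int y"
    using assms(1) by (rule mem_cyc_cosetE)
  \<comment> \<open>Multiplication by \<open>2 ^ (m - j)\<close> turns \<open>2 ^ j\<close> into
    \<open>2 ^ m\<close>, that is into \<open>-1\<close>, which isolates \<open>x\<close>.\<close>
  have "int n dvd int x * int n - (int x * 2 ^ j + e * int y) * 2 ^ (m - j)"
    using d by (intro dvd_diff dvd_mult2 dvd_triv_right)
  also have "int x * int n - (int x * 2 ^ j + e * int y) * 2 ^ (m - j)
     = int x - e * (int y * 2 ^ (m - j))"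
  proof -
    have "(2::int) ^ j * 2 ^ (m - j) = 2 ^ m" using j by (simp add: power_add[symmetric])
    thus ?thesis by (simp add: n_eq algebra_simps)
  qed
  finally have *: "int n dvd int x - e * (int y * 2 ^ (m - j))" .
  from e show ?thesis
  proof
    assume "e = 1"
    thus ?thesis using * assms(2) by (intro mem_cyc_cosetI[of _ _ "m - j"]) (auto simp: dvd_diff_commute)
  next
    assume "e = - 1"
    thus ?thesis using * assms(2) by (intro mem_cyc_cosetI_neg[of _ _ "m - j"]) (auto simp: add_ac)
  qed
qed

lemma cyc_coset_neg:
  assumes "y \<in> cyc_coset n x" and "0 < y"
  shows "n - y \<in> cyc_coset n x"
proof -
  have "y < n" using assms(1) by (rule mem_cyc_coset_less)
  hence "n - y \<in> cyc_coset n y" using assms(2) by (intro mem_cyc_cosetI_neg[of _ _ 0]) auto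
  thus ?thesis using assms(1) cyc_coset_trans by blast
qed

lemma cyc_coset_nonzero:
  assumes "y \<in> cyc_coset n x" and "0 < x" and "x < n"
  shows "0 < y"
proof (rule ccontr)
  assume "\<not> 0 < y"
  hence "x \<in> cyc_coset n 0" using cyc_coset_sym[OF assms(1,3)] by simp
  thus False using assms(2) by (simp add: cyc_coset_def)
qed

lemma cyc_coset_half:
  assumes x: "x < n" "x \<in> cyc_coset n y" "even x"
  shows "x div 2 \<in> cyc_coset n y"
proof -
  have "x \<in> cyc_coset n (x div 2)"
    using x by (intro mem_cyc_cosetI[of _ _ 1]) (auto elim!: evenE)
  hence "x div 2 \<in> cyc_coset n x" by (rule cyc_coset_sym) (use x(1) in simp)
  thus ?thesis using x(2) cyc_coset_trans by blast
qed

lemma cyc_coset_zero: "cyc_coset n 0 = {0}"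
  by (auto simp: cyc_coset_def)

text \<open>As \<open>2 ^ (2 * m)\<close> is 1 modulo \<open>n\<close>, the first
  \<open>2 * m\<close> powers cover the coset. A repetition at distance below \<open>m\<close>
  contradicts \<open>pos\<close>; one at distance \<open>i + m\<close> contradicts
  \<open>neg\<close> at \<open>i\<close>, since \<open>m\<close> doublings change the sign.\<close>

lemma card_cyc_coset:
  assumes "x < n"
    and pos: "\<And>j. j < m \<Longrightarrow> int n dvd int x * 2 ^ j - int x \<Longrightarrow> j = 0"
    and neg: "\<And>j. j < m \<Longrightarrow> \<not> int n dvd int x * 2 ^ j + int x"
  shows "card (cyc_coset n x) = 2 * m"
proof -
  define f where "f = (\<lambda>j. x * 2 ^ j mod n)"
  have "cyc_coset n x = f ` {..<2 * m}"
  proof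
    show "cyc_coset n x \<subseteq> f ` {..<2 * m}"
    proof
      fix y assume y: "y \<in> cyc_coset n x"
      then obtain j e where j: "j < m" and e: "e = 1 \<or> e = - 1" and d: "int n dvd int x * 2 ^ j + e * int y"
        by (rule mem_cyc_cosetE)
      have yn: "y < n" using y by (rule mem_cyc_coset_less)
      have "\<exists>k<2 * m. int n dvd int x * 2 ^ k - int y"
        using e
      proof
        assume "e = - 1"
        thus ?thesis using d j by (intro exI[of _ j]) auto
      next
        assume "e = 1"
        moreover have "int x * 2 ^ (j + m) - int y = int x * 2 ^ j * int n - (int x * 2 ^ j + int y)"
          by (simp add: n_eq power_add algebra_simps)
        ultimately have "int n dvd int x * 2 ^ (j + m) - int y"
          using d by (simp only: mult_1) (intro dvd_diff dvd_triv_right)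
        thus ?thesis using j by (intro exI[of _ "j + m"]) auto
      qed
      then obtain k where k: "k < 2 * m" "[int (x * 2 ^ k) = int y] (mod int n)"
        by (auto simp: cong_iff_dvd_diff)
      hence "[x * 2 ^ k = y] (mod n)" by (simp only: cong_int_iff)
      hence "y = f k" using yn by (simp add: f_def cong_def)
      thus "y \<in> f ` {..<2 * m}" using k by blast
    qed
  qed (auto simp: f_def cyc_coset_def)
  moreover have False if ab: "a < b" "b < 2 * m" "f a = f b" for a b
  proof -
    have "[2 ^ a * (x * 2 ^ (b - a)) = 2 ^ a * x] (mod n)"
      using ab by (simp add: f_def cong_def mult_ac power_add[symmetric])
    hence "[x * 2 ^ (b - a) = x] (mod n)" by (rule double_mod_cancel[OF odd_n])
    hence "[int (x * 2 ^ (b - a)) = int x] (mod int n)" by (simp only: cong_int_iff)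
    hence d: "int n dvd int x * 2 ^ (b - a) - int x" by (simp add: cong_iff_dvd_diff)
    show False
    proof (cases "b - a < m")
      case True
      thus False using pos[OF True d] ab by simp
    next
      case False
      define i where "i = b - a - m"
      have "int x * 2 ^ i + int x = int x * 2 ^ i * int n - (int x * 2 ^ (b - a) - int x)"
      proof -
        have "b - a = i + m" using False by (simp add: i_def)
        thus ?thesis by (simp add: n_eq power_add algebra_simps)
      qed
      hence "int n dvd int x * 2 ^ i + int x" using dvd_diff[OF dvd_triv_right d] by (simp only:)
      moreover have "i < m" using ab by (simp add: i_def)
      ultimately show False using neg by blast
    qed
  qed
  hence "inj_on f {..<2 * m}" unfolding inj_on_def by (metis lessThan_iff linorder_neqE_nat)
  ultimately show ?thesis by (simp add: card_image)
qed

section \<open>Defining sets as unions of cosets\<close>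

lemma mem_bch_zeros_iff: "y \<in> bch_zeros n \<delta> \<longleftrightarrow> (\<exists>x. 0 < x \<and> x < \<delta> \<and> y \<in> cyc_coset n x)"
  by (auto simp: bch_zeros_def Suc_le_eq Bex_def)

lemma zero_notin_bch_zeros: "\<delta> \<le> n \<Longrightarrow> 0 \<notin> bch_zeros n \<delta>"
  unfolding mem_bch_zeros_iff using cyc_coset_nonzero by (meson less_le_trans less_irrefl)

lemma bch_zeros_subset: "bch_zeros n \<delta> \<subseteq> {..<n}"
  by (auto simp: mem_bch_zeros_iff mem_cyc_coset_less)

lemma doubling_closed_bch_zeros: "doubling_closed n (bch_zeros n \<delta>)"
  using doubling_closed_cyc_coset[of n] n_ge
  unfolding doubling_closed_def bch_zeros_def by fastforce

text \<open>Only odd new elements need checking: an even one is the double of a smaller element,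
  already covered by induction.\<close>

lemma bch_zeros_absorb:
  assumes "a \<le> b" and "b \<le> n"
    and odd: "\<And>x. a \<le> x \<Longrightarrow> x < b \<Longrightarrow> odd x \<Longrightarrow> \<exists>y. 0 < y \<and> y < a \<and> x \<in> cyc_coset n y"
  shows "bch_zeros n b = bch_zeros n a"
proof
  show "bch_zeros n a \<subseteq> bch_zeros n b" using assms(1) by (force simp: mem_bch_zeros_iff)
  have "x \<in> bch_zeros n a" if "0 < x" "x < b" for x
    using that
  proof (induction x rule: less_induct)
    case (less x)
    consider "x < a" | "a \<le> x" "odd x" | "even x" by linarith
    thus ?case
    proof cases
      case 1
      thus ?thesis using less.prems assms(2) cyc_coset_self by (auto simp: mem_bch_zeros_iff)
    next
      case 2
      thus ?thesis using odd less.prems by (auto simp: mem_bch_zeros_iff)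
    next
      case 3
      hence "x div 2 \<in> bch_zeros n a" using less by (auto elim!: evenE)
      hence "2 * (x div 2) mod n \<in> bch_zeros n a"
        using doubling_closed_bch_zeros by (simp add: doubling_closed_def)
      thus ?thesis using 3 less.prems assms(2) by simp
    qed
  qed
  hence "y \<in> bch_zeros n a" if "0 < x" "x < b" "y \<in> cyc_coset n x" for x y
    using that cyc_coset_trans unfolding mem_bch_zeros_iff by meson
  thus "bch_zeros n b \<subseteq> bch_zeros n a" unfolding mem_bch_zeros_iff[of _ b] subset_iff by blast
qed

lemma card_UN_cyc_coset:
  assumes "finite L" and "\<And>x. x \<in> L \<Longrightarrow> x < n"
    and disj: "\<And>x y. x \<in> L \<Longrightarrow> y \<in> L \<Longrightarrow> y \<in> cyc_coset n x \<Longrightarrow> x = y"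
  shows "card (\<Union>x\<in>L. cyc_coset n x) = (\<Sum>x\<in>L. card (cyc_coset n x))"
proof (rule card_UN_disjoint)
  show "\<forall>x\<in>L. finite (cyc_coset n x)"
    using mem_cyc_coset_less by (auto intro: finite_subset[of _ "{..<n}"])
  show "\<forall>x\<in>L. \<forall>y\<in>L. x \<noteq> y \<longrightarrow> cyc_coset n x \<inter> cyc_coset n y = {}"
  proof (intro ballI impI equals0I)
    fix x y z assume xy: "x \<in> L" "y \<in> L" "x \<noteq> y" and "z \<in> cyc_coset n x \<inter> cyc_coset n y"
    hence z: "z \<in> cyc_coset n x" "z \<in> cyc_coset n y" by auto
    have "y \<in> cyc_coset n x" by (rule cyc_coset_trans[OF z(1) cyc_coset_sym[OF z(2) assms(2)[OF xy(2)]]])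
    thus False using disj xy by blast
  qed
qed (rule assms(1))

end

section \<open>From defining sets to code parameters\<close>

lemma min_dist_ge:
  assumes "C \<subseteq> words n" and "1 < card C" and "\<And>c. c \<in> C \<Longrightarrow> c \<noteq> (\<lambda>_. False) \<Longrightarrow> d \<le> hweight c"
  shows "d \<le> min_dist C"
proof -
  \<comment> \<open>\<open>Min\<close> is meaningful only on a nonempty finite set, so a nonzero
    codeword has to exist.\<close>
  have "C - {\<lambda>_. False} \<noteq> {}"
  proof
    assume "C - {\<lambda>_. False} = {}"
    hence "card C \<le> card {\<lambda>_::nat. False}" by (intro card_mono) auto
    thus False using assms(2) by simp
  qed
  moreover have "finite C" using assms(1) finite_words finite_subset by blast
  ultimately show ?thesis unfolding min_dist_def using assms(3) by (subst Min_ge_iff) auto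
qed

context two_pow_plus_one
begin

lemma bch_code_narrow: "bch_code n xi \<delta> 1 = cyclic_code n xi (bch_zeros n \<delta>)"
  by (simp add: bch_code_def bch_zeros_def)

lemma bch_code_zero:
  assumes "0 < \<delta>"
  shows "bch_code n xi (\<delta> + 1) 0 = cyclic_code n xi (insert 0 (bch_zeros n \<delta>))"
proof -
  have "{0..<\<delta>} = insert 0 {1..<\<delta>}" using assms by auto
  thus ?thesis by (simp add: bch_code_def bch_zeros_def cyc_coset_zero)
qed

text \<open>The distance bound depends only on the defining set, so any \<open>\<delta>'\<close>
  with the same defining set may replace \<open>\<delta>\<close>; a larger one gives a better
  bound.\<close>

lemma bch_code_narrow_params:
  fixes xi :: "'a::field"
  assumes char2: "(2::'a) = 0" and xi: "prim_root n xi"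
    and \<delta>: "\<delta> \<le> n" and eq: "bch_zeros n \<delta> = bch_zeros n \<delta>'" and \<delta>': "0 < \<delta>'" "\<delta>' \<le> n"
    and z: "card (bch_zeros n \<delta>) = z"
  shows "code_dim (bch_code n xi \<delta> 1) (n - z)" and "\<delta>' \<le> min_dist (bch_code n xi \<delta> 1)"
proof -
  let ?C = "bch_code n xi \<delta> 1"
  have card: "card ?C = 2 ^ (n - z)"
    unfolding bch_code_narrow z[symmetric]
    by (rule card_cyclic_code[OF char2 xi odd_n doubling_closed_bch_zeros])
  thus "code_dim ?C (n - z)" by (simp add: code_dim_def)
  \<comment> \<open>The residue 0 is not a zero of the code, so the dimension is positive and a
    nonzero codeword exists.\<close>
  have "bch_zeros n \<delta> \<subseteq> {0<..<n}"
    using bch_zeros_subset[of \<delta>] zero_notin_bch_zeros[OF \<delta>] by (force intro: gr0I)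
  from card_mono[OF _ this] have "z < n" using z n_ge by simp
  have "\<delta>' \<le> hweight c" if "c \<in> ?C" "c \<noteq> (\<lambda>_. False)" for c
  proof -
    have "spectrum n xi c (1 + j) = 0" if "j < \<delta>' - 1" for j
    proof -
      have "1 + j \<in> cyc_coset n (1 + j)" using that \<delta>' by (intro cyc_coset_self) auto
      hence "1 + j \<in> bch_zeros n \<delta>'" using that unfolding mem_bch_zeros_iff by (intro exI[of _ "1 + j"]) auto
      thus ?thesis using \<open>c \<in> ?C\<close> unfolding bch_code_narrow cyclic_code_altdef eq by blast
    qed
    hence "\<delta>' - 1 < hweight c"
      using that unfolding bch_code_narrow cyclic_code_altdef by (intro bch_bound[OF xi, where b = 1]) auto
    thus ?thesis by simp
  qed
  moreover have "1 < card ?C" unfolding card using \<open>z < n\<close> by (intro one_less_power) auto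
  moreover have "?C \<subseteq> words n" unfolding bch_code_narrow cyclic_code_altdef by blast
  ultimately show "\<delta>' \<le> min_dist ?C" by (intro min_dist_ge) auto
qed

text \<open>Cosets are closed under negation, so the zeros include every residue of absolute
  value below \<open>\<delta>\<close>; this doubles the bound.\<close>
lemma bch_code_zero_params:
  fixes xi :: "'a::field"
  assumes char2: "(2::'a) = 0" and xi: "prim_root n xi"
    and \<delta>: "0 < \<delta>" "\<delta> \<le> n" and eq: "bch_zeros n \<delta> = bch_zeros n \<delta>'" and \<delta>': "0 < \<delta>'" "\<delta>' \<le> n"
    and z: "card (bch_zeros n \<delta>) = z" and N: "N \<notin> bch_zeros n \<delta>" "0 < N" "N < n"
  shows "code_dim (bch_code n xi (\<delta> + 1) 0) (2 ^ m - z)"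
    and "2 * \<delta>' \<le> min_dist (bch_code n xi (\<delta> + 1) 0)"
proof -
  let ?C = "bch_code n xi (\<delta> + 1) 0" and ?T = "insert 0 (bch_zeros n \<delta>)"
  have fin: "finite (bch_zeros n \<delta>)" using bch_zeros_subset by (rule finite_subset) simp
  have T: "doubling_closed n ?T"
    using doubling_closed_bch_zeros[of \<delta>] n_ge by (auto simp: doubling_closed_def)
  have cardT: "card ?T = Suc z" using fin zero_notin_bch_zeros[OF \<delta>(2)] z by simp
  have card: "card ?C = 2 ^ (2 ^ m - z)"
  proof -
    have "n - Suc z = 2 ^ m - z" by (simp add: n_eq)
    thus ?thesis unfolding bch_code_zero[OF \<delta>(1)]
      by (simp only: card_cyclic_code[OF char2 xi odd_n T] cardT)
  qed
  thus "code_dim ?C (2 ^ m - z)" by (simp add: code_dim_def)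
  \<comment> \<open>With 0 now among the zeros, \<open>N\<close> is the residue that keeps the code
    from being trivial.\<close>
  have "?T \<subseteq> {..<n} - {N}" using bch_zeros_subset[of \<delta>] N n_ge by auto
  from card_mono[OF _ this] have "z < 2 ^ m" using cardT N n_eq by simp
  have C: "?C = cyclic_code n xi ?T" by (rule bch_code_zero[OF \<delta>(1)])
  have "2 * \<delta>' \<le> hweight c" if c: "c \<in> ?C" "c \<noteq> (\<lambda>_. False)" for c
  proof -
    have zero: "spectrum n xi c j = 0" if "j \<in> ?T" for j
      using c(1) that unfolding C cyclic_code_altdef by blast
    have small: "a \<in> cyc_coset n a" "a \<in> bch_zeros n \<delta>" if "0 < a" "a < \<delta>'" for a
    proof -
      show "a \<in> cyc_coset n a" using that \<delta>' by (intro cyc_coset_self) auto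
      thus "a \<in> bch_zeros n \<delta>" unfolding eq mem_bch_zeros_iff using that by blast
    qed
    \<comment> \<open>The window runs through the \<open>2 * \<delta>' - 1\<close> consecutive
      residues from \<open>-(\<delta>' - 1)\<close> to \<open>\<delta>' - 1\<close>; the case split
      separates the negative ones from the others.\<close>
    have "spectrum n xi c (n - (\<delta>' - 1) + j) = 0" if j: "j < 2 * \<delta>' - 1" for j
    proof -
      have "(n - (\<delta>' - 1) + j) mod n \<in> ?T"
      proof (cases "j < \<delta>' - 1")
        case True
        define a where "a = \<delta>' - 1 - j"
        have a: "0 < a" "a < \<delta>'" "n - (\<delta>' - 1) + j = n - a" using True \<delta>' by (auto simp: a_def)
        have "n - a \<in> bch_zeros n \<delta>" unfolding eq mem_bch_zeros_iff
          using a(1,2) cyc_coset_neg[OF small(1)[OF a(1,2)] a(1)] by blast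
        thus ?thesis unfolding a(3) using a(1) n_ge by simp
      next
        case False
        define a where "a = j - (\<delta>' - 1)"
        have a: "a < \<delta>'" "n - (\<delta>' - 1) + j = n + a" using False \<delta>' j by (auto simp: a_def)
        have "(n - (\<delta>' - 1) + j) mod n = a" using a \<delta>' by simp
        thus ?thesis using small(2)[OF _ a(1)] by (cases "a = 0") auto
      qed
      moreover have "xi ^ n = 1" using xi by (simp add: prim_root_def)
      ultimately show ?thesis using zero spectrum_mod by metis
    qed
    hence "2 * \<delta>' - 1 < hweight c"
      using c unfolding C cyclic_code_altdef by (intro bch_bound[OF xi, where b = "n - (\<delta>' - 1)"]) auto
    thus ?thesis by simp
  qed
  moreover have "1 < card ?C" unfolding card using \<open>z < 2 ^ m\<close> by (intro one_less_power) auto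
  moreover have "?C \<subseteq> words n" unfolding C cyclic_code_altdef by blast
  ultimately show "2 * \<delta>' \<le> min_dist ?C" by (intro min_dist_ge) auto
qed

end

section \<open>Small coset leaders\<close>

text \<open>Write \<open>P = 2 ^ t\<close> and \<open>n = 2 * P\<^sup>2 + 1\<close>. For \<open>j > 0\<close> parity and size force
  \<open>x * 2 ^ j + e * y = n\<close>, that is \<open>e * y = 1 + 2 ^ j * a\<close> with \<open>a = 2 * P\<^sup>2 / 2 ^ j - x\<close>; the bounds
  on \<open>x\<close> and \<open>y\<close> then leave only \<open>j = t\<close> and odd \<open>a\<close> with \<open>\<bar>a\<bar> \<le> 3\<close>.\<close>
lemma small_leader_collision:
  fixes x y e :: int and t j :: nat
  assumes "4 \<le> t" and "odd x" and "odd y" and "0 < x" and "0 < y"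
    and x: "x < 4 * 2 ^ t - 8" and y: "y < 4 * 2 ^ t - 8"
    and "j \<le> t" and e: "e = 1 \<or> e = - 1"
    and dvd: "2 * (2 ^ t)\<^sup>2 + 1 dvd x * 2 ^ j + e * y"
  shows "j = 0 \<and> e = - 1 \<and> x = y \<or>
    x \<in> {2 * 2 ^ t - 1, 2 * 2 ^ t + 1} \<or> y \<in> {3 * 2 ^ t - 1, 3 * 2 ^ t + 1}"
proof -
  define P :: int where "P = 2 ^ t"
  define J :: int where "J = 2 ^ j"
  define G :: int where "G = 2 ^ (t - j)"
  have P: "16 \<le> P" using power_increasing[OF assms(1), of "2::int"] by (simp add: P_def)
  have PJG: "P = J * G" using \<open>j \<le> t\<close> by (simp add: P_def J_def G_def power_add[symmetric])
  have J1: "1 \<le> J" and G1: "1 \<le> G" by (auto simp: J_def G_def)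
  have PP: "16 * P \<le> P\<^sup>2" using mult_right_mono[OF P, of P] P by (simp add: power2_eq_square)
  define M where "M = 2 * P\<^sup>2 + 1"
  obtain w where w: "x * J + e * y = M * w" using dvd by (auto simp: P_def J_def M_def)
  have M0: "0 \<le> M" by (simp add: M_def)
  note xy = x[folded P_def] y[folded P_def]
  have ey: "- (4 * P) < e * y" "e * y < 4 * P" using e xy assms(4,5) by auto
  have JP: "J \<le> P" using PJG G1 J1 mult_left_mono[of 1 G J] by simp
  have "x * J \<le> (4 * P - 8) * P" using xy JP J1 assms(4) P by (intro mult_mono) auto
  hence xJ: "x * J \<le> 4 * P\<^sup>2 - 8 * P" by (simp add: algebra_simps power2_eq_square)
  have xJ0: "0 < x * J" using assms(4) J1 by simp
  have w1: "w < 3"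
  proof (rule ccontr)
    assume "\<not> w < 3"
    hence "M * 3 \<le> M * w" using M0 by (intro mult_left_mono) auto
    thus False using M_def w xJ ey PP P by linarith
  qed
  have w0: "0 \<le> w"
  proof (rule ccontr)
    assume "\<not> 0 \<le> w"
    hence "M * w \<le> M * (- 1)" using M0 by (intro mult_left_mono) auto
    thus False using M_def w xJ0 ey PP P by linarith
  qed
  show ?thesis
  proof (cases "j = 0")
    case True
    hence "J = 1" by (simp add: J_def)
    have "w = 0"
    proof (rule ccontr)
      assume "w \<noteq> 0"
      hence "M * 1 \<le> M * w" using w0 M0 by (intro mult_left_mono) auto
      moreover have "x + e * y = M * w" using w \<open>J = 1\<close> by simp
      ultimately show False using M_def xy(1) ey PP P by linarith
    qed
    thus ?thesis using w \<open>J = 1\<close> True e assms(4,5) by auto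
  next
    case False
    hence "even J" by (simp add: J_def)
    \<comment> \<open>\<open>J\<close> is even while \<open>y\<close> and \<open>M\<close> are odd,
      so \<open>w\<close> is odd; among 0, 1, 2 this leaves 1.\<close>
    hence "odd (x * J + e * y)" using assms(3) e by auto
    hence "odd w" unfolding w by (simp add: M_def)
    hence "w = 1" using w0 w1 by presburger
    define a where "a = 2 * P * G - x"
    have ya: "e * y = 1 + J * a"
      using w \<open>w = 1\<close> by (simp add: a_def M_def PJG algebra_simps power2_eq_square)
    show ?thesis
    proof (cases "j = t")
      case True
      hence "G = 1" "J = P" by (auto simp: G_def PJG)
      hence xa: "x = 2 * P - a" by (simp add: a_def)
      have "odd a" using assms(2) xa by simp
      from e show ?thesis
      proof
        assume "e = 1"
        hence "y = 1 + P * a" using ya \<open>J = P\<close> by simp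
        hence "P * (- 1) < P * a" "P * a < P * 4" using xy(2) assms(5) P by linarith+
        hence "- 1 < a" "a < 4" using P mult_left_less_imp_less[of P "- 1" a] by auto
        \<comment> \<open>The value \<open>a = 1\<close> gives \<open>x = 2 * P - 1\<close>, and
          \<open>a = 3\<close> gives \<open>y = 3 * P + 1\<close>.\<close>
        hence "a = 1 \<or> a = 3" using \<open>odd a\<close> by presburger
        thus ?thesis using xa ya \<open>e = 1\<close> \<open>J = P\<close> by (auto simp: P_def)
      next
        assume "e = - 1"
        hence "y = - 1 - P * a" using ya \<open>J = P\<close> by simp
        hence "P * (- 4) < P * a" "P * a < P * 0" using xy(2) assms(5) P by linarith+
        hence "- 4 < a" "a < 0" using P mult_left_less_imp_less[of P "- 4" a] mult_left_less_imp_less[of P a 0] by auto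
        \<comment> \<open>The value \<open>a = - 1\<close> gives \<open>x = 2 * P + 1\<close>, and
          \<open>a = - 3\<close> gives \<open>y = 3 * P - 1\<close>.\<close>
        hence "a = - 1 \<or> a = - 3" using \<open>odd a\<close> by presburger
        thus ?thesis using xa ya \<open>e = - 1\<close> \<open>J = P\<close> by (auto simp: P_def)
      qed
    next
      case False
      \<comment> \<open>For \<open>j < t\<close> the number \<open>G\<close> is even. The bound on
        \<open>y\<close> gives \<open>a < 4 * G = 8 * H\<close>, hence
        \<open>x > (4 * P - 8) * H\<close>, which is at least the upper bound assumed for
        \<open>x\<close>.\<close>
      define H :: int where "H = 2 ^ (t - j - 1)"
      have H1: "1 \<le> H" by (simp add: H_def)
      have "t - j = Suc (t - j - 1)" using False \<open>j \<le> t\<close> by simp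
      hence GH: "G = 2 * H" unfolding G_def H_def by (metis power_Suc)
      have "e * y < 4 * P - 8" using e xy(2) P assms(5) by auto
      hence "J * a < J * (4 * G)" using ya PJG by (simp add: algebra_simps)
      hence "a < 8 * H" using J1 GH mult_left_less_imp_less[of J a "4 * G"] by simp
      hence "4 * P * H - 8 * H < x" by (simp add: a_def GH)
      moreover have "(4 * P - 8) * 1 \<le> (4 * P - 8) * H" using H1 P by (intro mult_left_mono) auto
      ultimately have False using xy(1) by (simp add: algebra_simps)
      thus ?thesis ..
    qed
  qed
qed

lemma card_odd_lessThan: "card {x. odd x \<and> x < 2 * k + 1} = (k :: nat)"
proof -
  have "{x. odd x \<and> x < 2 * k + 1} = (\<lambda>i. 2 * i + 1) ` {..<k}"
    by (auto elim!: oddE)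
  thus ?thesis by (simp add: card_image inj_on_def)
qed

locale two_pow_plus_one_odd = two_pow_plus_one +
  fixes t :: nat
  assumes m_eq: "m = 2 * t + 1" and t_ge: "5 \<le> t"
begin

text \<open>These are the only odd numbers below \<open>4 * 2 ^ t - 8\<close> that are not the least
  element of their coset.\<close>

definition nonleaders :: "nat set" where
  "nonleaders = {2 * 2 ^ t - 1, 2 * 2 ^ t + 1, 3 * 2 ^ t - 1, 3 * 2 ^ t + 1}"

text \<open>For odd \<open>\<delta>\<close> up to \<open>4 * 2 ^ t - 7\<close> these are the coset
  leaders below \<open>\<delta>\<close>; beyond that they still represent all cosets involved,
  possibly with repetitions.\<close>

definition small_leaders :: "nat \<Rightarrow> nat set" where
  "small_leaders \<delta> = {x. odd x \<and> x < \<delta>} - nonleaders"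

lemma n_eq_square: "n = 2 * (2 ^ t)\<^sup>2 + 1"
  by (simp add: n_eq m_eq power_mult[symmetric] mult.commute)

lemma pow_t_ge: "32 \<le> (2::nat) ^ t"
  using power_increasing[OF t_ge, of "2::nat"] by simp

lemma n_large: "64 * 2 ^ t < n"
  using mult_le_mono1[OF pow_t_ge, of "2 ^ t"] unfolding n_eq_square power2_eq_square by linarith

text \<open>For distinct arguments this separates cosets; for \<open>y = x\<close> it shows that a
  coset has full size \<open>2 * m\<close>.\<close>

lemma small_leader_unique:
  assumes x: "x \<in> small_leaders (4 * 2 ^ t - 8)" and y: "y \<in> small_leaders (4 * 2 ^ t - 8)"
    and "j < m" and e: "e = 1 \<or> e = - 1" and dvd: "int n dvd int x * 2 ^ j + e * int y"
  shows "j = 0 \<and> e = - 1 \<and> x = y"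
proof -
  have n: "int n = 2 * (2 ^ t)\<^sup>2 + 1" by (simp add: n_eq_square)
  have P: "(32::int) \<le> 2 ^ t" using power_increasing[OF t_ge, of "2::int"] by simp
  \<comment> \<open>The conditions move to the integers, where the subtractions are no longer
    truncated.\<close>
  have *: "odd (int z) \<and> 0 < int z \<and> int z < 4 * 2 ^ t - 8 \<and>
      int z \<notin> {2 * 2 ^ t - 1, 2 * 2 ^ t + 1, 3 * 2 ^ t - 1, 3 * 2 ^ t + 1}"
    if "z \<in> small_leaders (4 * 2 ^ t - 8)" for z
  proof -
    have z: "odd z" "z < 4 * 2 ^ t - 8" "z \<notin> nonleaders" using that by (auto simp: small_leaders_def)
    have "0 < z" using z(1) by (rule odd_pos)
    moreover have "int z < 4 * 2 ^ t - 8"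
    proof -
      have "z + 8 < 4 * 2 ^ t" using z(2) by linarith
      hence "int (z + 8) < int (4 * 2 ^ t)" by (simp only: of_nat_less_iff)
      thus ?thesis by simp
    qed
    moreover have "int z \<noteq> 2 * 2 ^ t - 1"
    proof
      assume "int z = 2 * 2 ^ t - 1"
      hence "int (z + 1) = int (2 * 2 ^ t)" by simp
      hence "z + 1 = 2 * 2 ^ t" by (simp only: of_nat_eq_iff)
      hence "z = 2 * 2 ^ t - 1" by linarith
      thus False using z(3) unfolding nonleaders_def by blast
    qed
    moreover have "int z \<noteq> 3 * 2 ^ t - 1"
    proof
      assume "int z = 3 * 2 ^ t - 1"
      hence "int (z + 1) = int (3 * 2 ^ t)" by simp
      hence "z + 1 = 3 * 2 ^ t" by (simp only: of_nat_eq_iff)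
      hence "z = 3 * 2 ^ t - 1" by linarith
      thus False using z(3) unfolding nonleaders_def by blast
    qed
    moreover have "int z \<noteq> 2 * 2 ^ t + 1"
    proof
      assume "int z = 2 * 2 ^ t + 1"
      hence "int z = int (2 * 2 ^ t + 1)" by simp
      hence "z = 2 * 2 ^ t + 1" by (simp only: of_nat_eq_iff)
      thus False using z(3) by (simp add: nonleaders_def)
    qed
    moreover have "int z \<noteq> 3 * 2 ^ t + 1"
    proof
      assume "int z = 3 * 2 ^ t + 1"
      hence "int z = int (3 * 2 ^ t + 1)" by simp
      hence "z = 3 * 2 ^ t + 1" by (simp only: of_nat_eq_iff)
      thus False using z(3) by (simp add: nonleaders_def)
    qed
    ultimately show ?thesis using z(1) by simp
  qed
  note X = *[OF x] and Y = *[OF y]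
  have t4: "4 \<le> t" using t_ge by simp
  show ?thesis
  proof (cases "j \<le> t")
    case True
    have "j = 0 \<and> e = - 1 \<and> int x = int y \<or>
      int x \<in> {2 * 2 ^ t - 1, 2 * 2 ^ t + 1} \<or> int y \<in> {3 * 2 ^ t - 1, 3 * 2 ^ t + 1}"
      by (rule small_leader_collision) (use X Y t4 True e dvd n in auto)
    thus ?thesis using X Y by simp
  next
    case False
    \<comment> \<open>For \<open>j > t\<close> multiplication by \<open>2 ^ (m - j)\<close>
      exchanges \<open>x\<close> and \<open>y\<close>, and the new exponent \<open>m - j\<close> is
      at most \<open>t\<close>.\<close>
    have "int n dvd int x * int n * e - (int x * 2 ^ j + e * int y) * (e * 2 ^ (m - j))"
      by (rule dvd_diff[OF _ dvd_mult2[OF dvd]]) simp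
    also have "int x * int n * e - (int x * 2 ^ j + e * int y) * (e * 2 ^ (m - j))
       = - (int y * 2 ^ (m - j) + (- e) * int x)"
    proof -
      have "(2::int) ^ j * 2 ^ (m - j) = 2 ^ m" using \<open>j < m\<close> by (simp add: power_add[symmetric])
      thus ?thesis using e by (auto simp: n_eq algebra_simps)
    qed
    finally have d: "int n dvd int y * 2 ^ (m - j) + (- e) * int x" by (simp only: dvd_minus_iff)
    have "m - j = 0 \<and> - e = - 1 \<and> int y = int x \<or>
      int y \<in> {2 * 2 ^ t - 1, 2 * 2 ^ t + 1} \<or> int x \<in> {3 * 2 ^ t - 1, 3 * 2 ^ t + 1}"
    proof (rule small_leader_collision)
      show "m - j \<le> t" using False m_eq by simp
      show "2 * (2 ^ t)\<^sup>2 + 1 dvd int y * 2 ^ (m - j) + (- e) * int x" using d n by simp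
    qed (use X Y t4 e in auto)
    thus ?thesis using X Y \<open>j < m\<close> by simp
  qed
qed

text \<open>With \<open>P = 2 ^ t\<close>, the four products \<open>(2P-1)P\<close>,
  \<open>(2P+1)P\<close>, \<open>(2P+3)P\<close> and \<open>(2P-3)P\<close> differ from
  \<open>n = 2P^2 + 1\<close> by \<open>P+1\<close>, \<open>P-1\<close>, \<open>3P-1\<close> and
  \<open>3P+1\<close> up to sign. The first two relations are read backwards, the last two
  forwards.\<close>

lemma nonleader_partner:
  assumes "x \<in> nonleaders"
  obtains y where "0 < y" "y < x" "x \<in> cyc_coset n y"
proof -
  define P :: nat where "P = 2 ^ t"
  have P: "32 \<le> P" using pow_t_ge by (simp add: P_def)
  have n: "n = 2 * P * P + 1" by (simp add: n_eq_square P_def power2_eq_square)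
  have big: "64 * P < n" using n_large by (simp add: P_def)
  consider "x = 2 * P - 1" | "x = 2 * P + 1" | "x = 3 * P - 1" | "x = 3 * P + 1"
    using assms by (auto simp: nonleaders_def P_def)
  thus thesis
  proof cases
    case 1
    have "int x * 2 ^ t + int (P + 1) = int n" using P unfolding 1 n P_def[symmetric]
      by (simp add: P_def[symmetric] of_nat_diff algebra_simps) (simp add: P_def)
    hence "P + 1 \<in> cyc_coset n x" using big P by (intro mem_cyc_cosetI_neg[of _ _ t]) auto
    hence "x \<in> cyc_coset n (P + 1)" by (rule cyc_coset_sym) (use 1 big P in simp)
    thus ?thesis using 1 P by (intro that[of "P + 1"]) auto
  next
    case 2
    have "int x * 2 ^ t - int (P - 1) = int n" using P unfolding 2 n P_def[symmetric]
      by (simp add: P_def[symmetric] of_nat_diff algebra_simps) (simp add: P_def)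
    hence "P - 1 \<in> cyc_coset n x" using big P by (intro mem_cyc_cosetI[of _ _ t]) auto
    hence "x \<in> cyc_coset n (P - 1)" by (rule cyc_coset_sym) (use 2 big P in simp)
    thus ?thesis using 2 P by (intro that[of "P - 1"]) auto
  next
    case 3
    have "int (2 * P + 3) * 2 ^ t - int x = int n" using P unfolding 3 n P_def[symmetric]
      by (simp add: P_def[symmetric] of_nat_diff algebra_simps) (simp add: P_def)
    hence "x \<in> cyc_coset n (2 * P + 3)" using 3 big P by (intro mem_cyc_cosetI[of _ _ t]) auto
    thus ?thesis using 3 P by (intro that[of "2 * P + 3"]) auto
  next
    case 4
    have "int (2 * P - 3) * 2 ^ t + int x = int n" using P unfolding 4 n P_def[symmetric]
      by (simp add: P_def[symmetric] of_nat_diff algebra_simps) (simp add: P_def)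
    hence "x \<in> cyc_coset n (2 * P - 3)" using 4 big P by (intro mem_cyc_cosetI_neg[of _ _ t]) auto
    thus ?thesis using 4 P by (intro that[of "2 * P - 3"]) auto
  qed
qed

text \<open>Descent: an even number lies in the coset of its half and a nonleader in that of its
  smaller partner, so each coset is reached from a remaining number.\<close>

lemma bch_zeros_small_leaders:
  assumes "\<delta> \<le> n"
  shows "bch_zeros n \<delta> = (\<Union>x\<in>small_leaders \<delta>. cyc_coset n x)"
proof
  show "(\<Union>x\<in>small_leaders \<delta>. cyc_coset n x) \<subseteq> bch_zeros n \<delta>"
    using odd_pos by (fastforce simp: mem_bch_zeros_iff small_leaders_def)
  have "\<exists>y\<in>small_leaders \<delta>. x \<in> cyc_coset n y" if "0 < x" "x < \<delta>" for x
    using that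
  proof (induction x rule: less_induct)
    case (less x)
    have *: ?case if y: "0 < y" "y < x" "x \<in> cyc_coset n y" for y
    proof -
      obtain z where "z \<in> small_leaders \<delta>" "y \<in> cyc_coset n z"
        using less.IH[OF y(2,1)] y(2) less.prems by auto
      thus ?thesis using cyc_coset_trans y(3) by blast
    qed
    have xn: "x < n" using less.prems assms by simp
    consider "x \<in> small_leaders \<delta>" | "x \<in> nonleaders" | "even x"
      using less.prems by (auto simp: small_leaders_def)
    thus ?case
    proof cases
      case 1
      thus ?thesis using cyc_coset_self[OF xn] by blast
    next
      case 2
      then obtain y where "0 < y" "y < x" "x \<in> cyc_coset n y" by (rule nonleader_partner)
      thus ?thesis by (rule *)
    next
      case 3
      have "x \<in> cyc_coset n (x div 2)"
        using 3 xn by (intro mem_cyc_cosetI[of _ _ 1]) (auto elim!: evenE)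
      thus ?thesis using 3 less.prems by (intro *[of "x div 2"]) (auto elim!: evenE)
    qed
  qed
  hence "y \<in> (\<Union>x\<in>small_leaders \<delta>. cyc_coset n x)" if "0 < x" "x < \<delta>" "y \<in> cyc_coset n x" for x y
    using that cyc_coset_trans by blast
  thus "bch_zeros n \<delta> \<subseteq> (\<Union>x\<in>small_leaders \<delta>. cyc_coset n x)"
    unfolding mem_bch_zeros_iff subset_iff by blast
qed

text \<open>There are \<open>(\<delta> - 1) div 2\<close> odd numbers below \<open>\<delta>\<close>;
  all but the nonleaders contribute disjoint cosets of size \<open>2 * m\<close>.\<close>

lemma card_bch_zeros_small:
  assumes \<delta>: "\<delta> \<le> 4 * 2 ^ t - 7" "odd \<delta>"
  shows "card (bch_zeros n \<delta>) = m * (\<delta> - 1) - 2 * m * card {x \<in> nonleaders. x < \<delta>}"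
proof -
  \<comment> \<open>An odd \<open>x\<close> below \<open>4 * 2 ^ t - 7\<close> cannot equal the even
    number \<open>4 * 2 ^ t - 8\<close>.\<close>
  have lt: "x < 4 * 2 ^ t - 8" if "x \<in> small_leaders \<delta>" for x
  proof -
    have "x < \<delta>" "odd x" using that by (auto simp: small_leaders_def)
    moreover have "even (4 * 2 ^ t - 8 :: nat)" by simp
    moreover have "x \<le> 4 * 2 ^ t - 8" using \<delta>(1) \<open>x < \<delta>\<close> by linarith
    ultimately show ?thesis by (metis le_neq_implies_less)
  qed
  have sub: "small_leaders \<delta> \<subseteq> small_leaders (4 * 2 ^ t - 8)"
    using lt by (auto simp: small_leaders_def)
  have xn: "x < n" if "x \<in> small_leaders \<delta>" for x using lt[OF that] n_large by simp
  have "\<delta> \<le> n" using \<delta>(1) n_large by simp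
  have fin: "finite (small_leaders \<delta>)" by (auto simp: small_leaders_def)
  have "card (bch_zeros n \<delta>) = (\<Sum>x\<in>small_leaders \<delta>. card (cyc_coset n x))"
    unfolding bch_zeros_small_leaders[OF \<open>\<delta> \<le> n\<close>]
  proof (rule card_UN_cyc_coset[OF fin xn])
    fix x y assume xy: "x \<in> small_leaders \<delta>" "y \<in> small_leaders \<delta>" and yx: "y \<in> cyc_coset n x"
    obtain j e where "j < m" "e = 1 \<or> e = - 1" "int n dvd int x * 2 ^ j + e * int y"
      using mem_cyc_cosetE[OF yx] by blast
    thus "x = y" using small_leader_unique xy sub by blast
  qed
  also have "\<dots> = (\<Sum>x\<in>small_leaders \<delta>. 2 * m)"
  proof (rule sum.cong[OF refl])
    fix x assume x: "x \<in> small_leaders \<delta>"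
    hence x': "x \<in> small_leaders (4 * 2 ^ t - 8)" using sub by blast
    show "card (cyc_coset n x) = 2 * m"
    proof (rule card_cyc_coset[OF xn[OF x]])
      fix j assume "j < m"
      show "j = 0" if "int n dvd int x * 2 ^ j - int x"
        using small_leader_unique[OF x' x' \<open>j < m\<close>, of "- 1"] that by simp
      show "\<not> int n dvd int x * 2 ^ j + int x"
        using small_leader_unique[OF x' x' \<open>j < m\<close>, of 1] by auto
    qed
  qed
  also have "\<dots> = 2 * m * card (small_leaders \<delta>)" by simp
  also have "card (small_leaders \<delta>) = (\<delta> - 1) div 2 - card {x \<in> nonleaders. x < \<delta>}"
  proof -
    obtain k where k: "\<delta> = 2 * k + 1" using \<delta>(2) by (auto elim: oddE)
    have odd: "odd x" if "x \<in> nonleaders" for x using that t_ge by (auto simp: nonleaders_def)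
    have "small_leaders \<delta> = {x. odd x \<and> x < \<delta>} - {x \<in> nonleaders. x < \<delta>}"
      by (auto simp: small_leaders_def)
    also have "card \<dots> = card {x. odd x \<and> x < \<delta>} - card {x \<in> nonleaders. x < \<delta>}"
      by (rule card_Diff_subset) (use odd in \<open>auto simp: nonleaders_def\<close>)
    finally show ?thesis using card_odd_lessThan[of k] by (simp add: k)
  qed
  also have "2 * m * ((\<delta> - 1) div 2 - card {x \<in> nonleaders. x < \<delta>})
      = m * (\<delta> - 1) - 2 * m * card {x \<in> nonleaders. x < \<delta>}"
    using \<delta>(2) by (auto elim!: oddE simp: diff_mult_distrib2)
  finally show ?thesis .
qed

lemma card_bch_zeros_range1:
  assumes "2 * 2 ^ t + 3 \<le> \<delta>" and "\<delta> \<le> 3 * 2 ^ t - 3" and "odd \<delta>"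
  shows "card (bch_zeros n \<delta>) = m * \<delta> - 5 * m"
proof -
  have "{x \<in> nonleaders. x < \<delta>} = {2 * 2 ^ t - 1, 2 * 2 ^ t + 1}"
    using assms(1,2) pow_t_ge unfolding nonleaders_def by auto
  hence "card {x \<in> nonleaders. x < \<delta>} = 2" using pow_t_ge by simp
  moreover have "\<delta> \<le> 4 * 2 ^ t - 7" using assms(2) pow_t_ge by linarith
  ultimately show ?thesis using card_bch_zeros_small[OF _ assms(3)]
    by (simp add: algebra_simps diff_mult_distrib2)
qed

text \<open>The range extends to \<open>4 * 2 ^ t - 7\<close> because the next range is reduced to
  this endpoint.\<close>

lemma card_bch_zeros_range2:
  assumes "3 * 2 ^ t + 3 \<le> \<delta>" and "\<delta> \<le> 4 * 2 ^ t - 7" and "odd \<delta>"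
  shows "card (bch_zeros n \<delta>) = m * \<delta> - 9 * m"
proof -
  have "{x \<in> nonleaders. x < \<delta>} = nonleaders"
    using assms(1) pow_t_ge unfolding nonleaders_def by auto
  moreover have "card nonleaders = 4"
  proof -
    define P :: nat where "P = 2 ^ t"
    have "32 \<le> P" using pow_t_ge by (simp add: P_def)
    hence "2 * P - 1 \<noteq> 2 * P + 1" "2 * P - 1 \<noteq> 3 * P - 1" "2 * P - 1 \<noteq> 3 * P + 1"
      "2 * P + 1 \<noteq> 3 * P - 1" "2 * P + 1 \<noteq> 3 * P + 1" "3 * P - 1 \<noteq> 3 * P + 1" by linarith+
    thus ?thesis unfolding nonleaders_def P_def[symmetric] by (simp del: One_nat_def)
  qed
  ultimately show ?thesis using card_bch_zeros_small[OF assms(2,3)]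
    by (simp add: algebra_simps diff_mult_distrib2)
qed

text \<open>With \<open>H = 2 ^ (t - 1)\<close> one has \<open>4 * 2 ^ t = 8H\<close> and
  \<open>n = 8H^2 + 1\<close>, so \<open>(8H - a)H = n - (aH + 1)\<close> and
  \<open>(8H + a)H = n + (aH - 1)\<close>. For \<open>a \<le> 7\<close> the numbers
  \<open>aH + 1\<close> and \<open>aH - 1\<close> lie below \<open>8H - 7\<close>, so nothing new is
  added.\<close>

lemma bch_zeros_range3:
  assumes "4 * 2 ^ t - 7 \<le> \<delta>" and "\<delta> \<le> 4 * 2 ^ t + 9"
  shows "bch_zeros n \<delta> = bch_zeros n (4 * 2 ^ t - 7)"
proof (rule bch_zeros_absorb[OF assms(1)])
  show "\<delta> \<le> n" using assms(2) n_large pow_t_ge by linarith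
  fix x :: nat assume x: "4 * 2 ^ t - 7 \<le> x" "x < \<delta>" "odd x"
  define H :: nat where "H = 2 ^ (t - 1)"
  have PH: "2 ^ t = 2 * H" using t_ge unfolding H_def by (metis Suc_diff_1 less_le_trans power_Suc zero_less_numeral)
  have H: "16 \<le> H" using pow_t_ge PH by simp
  have n: "n = 8 * H * H + 1" by (simp add: n_eq_square PH power2_eq_square)
  have xn: "x < n" using x(2) assms(2) n_large pow_t_ge by linarith
  have minus: "\<exists>y. 0 < y \<and> y < 4 * 2 ^ t - 7 \<and> x \<in> cyc_coset n y"
    if "x = 8 * H - a" "a \<le> 7" for a
  proof -
    have aH: "a * H \<le> 7 * H" using that(2) by (rule mult_right_mono) simp
    have "int x * 2 ^ (t - 1) + int (a * H + 1) = int n" using H that n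
      by (simp add: of_nat_diff algebra_simps) (simp add: H_def)
    moreover have "a * H + 1 < n" using aH n_large PH H by linarith
    ultimately have "a * H + 1 \<in> cyc_coset n x" by (intro mem_cyc_cosetI_neg[of _ _ "t - 1"]) auto
    hence "x \<in> cyc_coset n (a * H + 1)" using xn by (rule cyc_coset_sym)
    moreover have "a * H + 1 < 4 * 2 ^ t - 7" using aH PH H by linarith
    ultimately show ?thesis by (intro exI[of _ "a * H + 1"]) auto
  qed
  have plus: "\<exists>y. 0 < y \<and> y < 4 * 2 ^ t - 7 \<and> x \<in> cyc_coset n y"
    if "x = 8 * H + a" "a \<le> 7" "0 < a" for a
  proof -
    have aH: "a * H \<le> 7 * H" using that(2) by (rule mult_right_mono) simp
    have aH': "1 * H \<le> a * H" using that(3) by (intro mult_right_mono) auto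
    have "int x * 2 ^ (t - 1) - int (a * H - 1) = int n" using H that n aH'
      by (simp add: of_nat_diff algebra_simps) (simp add: H_def)
    moreover have "a * H - 1 < n" using aH n_large PH H by linarith
    ultimately have "a * H - 1 \<in> cyc_coset n x" by (intro mem_cyc_cosetI[of _ _ "t - 1"]) auto
    hence "x \<in> cyc_coset n (a * H - 1)" using xn by (rule cyc_coset_sym)
    moreover have "a * H - 1 < 4 * 2 ^ t - 7" "0 < a * H - 1" using aH aH' PH H by linarith+
    ultimately show ?thesis by (intro exI[of _ "a * H - 1"]) auto
  qed
  show "\<exists>y. 0 < y \<and> y < 4 * 2 ^ t - 7 \<and> x \<in> cyc_coset n y"
  proof (cases "x \<le> 8 * H")
    case True
    show ?thesis by (rule minus[of "8 * H - x"]) (use True x(1) PH H in auto)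
  next
    case False
    \<comment> \<open>The bound on \<open>\<delta>\<close> allows \<open>x\<close> up to
      \<open>8 * H + 8\<close>, which is even.\<close>
    have "x \<noteq> 8 * H + 8" using x(3) by auto
    hence "x - 8 * H \<le> 7" using x(2) assms(2) PH by linarith
    show ?thesis by (rule plus[of "x - 8 * H"]) (use False \<open>x - 8 * H \<le> 7\<close> in auto)
  qed
qed

end

section \<open>Large coset leaders\<close>

lemma two_pow_mod_3: "(2::nat) ^ i mod 3 = (if even i then 1 else 2)"
  by (induction i) (auto simp: mod_Suc, presburger+)

lemma two_pow_mod_3E:
  obtains w :: int where "2 ^ i = (if even i then 1 else 2) + 3 * w"
proof -
  have "(2::int) ^ i mod 3 = (if even i then 1 else 2)"
    using arg_cong[OF two_pow_mod_3[of i], of int] by (simp add: zmod_int)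
  hence "(2::int) ^ i = (if even i then 1 else 2) + 3 * (2 ^ i div 3)"
    by (metis add.commute mult_div_mod_eq)
  thus ?thesis by (rule that)
qed

context two_pow_plus_one_odd
begin

text \<open>\<open>third\<close> and \<open>sixth\<close> are \<open>dl 1\<close> and
  \<open>dl 2\<close> of the theorem and turn out to be the two largest coset leaders.\<close>

definition third :: nat where "third = n div 3"
definition sixth :: nat where "sixth = (n - 3) div 6"

text \<open>As \<open>m - 7\<close> is even, \<open>2 ^ (m - 7)\<close> is 1 modulo 3. In terms of
  \<open>u\<close> all quantities, including the last few powers of two used below, become linear,
  so that linear arithmetic can compare them.\<close>

lemma large_param:
  obtains u where "2 ^ (m - 7) = 3 * u + 1" and "5 \<le> u"
    and "n = 384 * u + 129" and "third = 128 * u + 43" and "sixth = 64 * u + 21"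
proof -
  define u :: nat where "u = 2 ^ (m - 7) div 3"
  have "even (m - 7)" using m_eq t_ge by simp
  hence "(2::nat) ^ (m - 7) mod 3 = 1" by (simp add: two_pow_mod_3)
  hence q: "2 ^ (m - 7) = 3 * u + 1" unfolding u_def by (metis mult_div_mod_eq)
  have "(2::nat) ^ 4 \<le> 2 ^ (m - 7)" using m_eq t_ge by (intro power_increasing) auto
  hence u5: "5 \<le> u" using q by simp
  have "m = 7 + (m - 7)" using m_eq t_ge by simp
  hence "(2::nat) ^ m = 2 ^ 7 * 2 ^ (m - 7)" by (metis power_add)
  hence nu: "n = 384 * u + 129" unfolding n_eq q by simp
  have "n div 3 = 128 * u + 43" "(n - 3) div 6 = 64 * u + 21" by (simp_all add: nu)
  hence "third = 128 * u + 43" "sixth = 64 * u + 21" by (simp_all only: third_def sixth_def)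
  thus ?thesis by (rule that[OF q u5 nu])
qed

lemma n_third: "n = 3 * third" and third_sixth: "third = 2 * sixth + 1" and odd_sixth: "odd sixth"
  and sixth_ge: "341 \<le> sixth"
  by (rule large_param; simp)+

text \<open>Since \<open>n = 3 * third\<close>, a multiple of \<open>third\<close> modulo
  \<open>n\<close> depends only on its factor modulo 3.\<close>

lemma cyc_coset_third: "cyc_coset n third = {third, 2 * third}"
proof -
  have *: "third * 2 ^ j mod n = third * (if even j then 1 else 2)" for j
  proof -
    have "n = third * 3" using n_third by simp
    hence "third * 2 ^ j mod n = third * 2 ^ j mod (third * 3)" by (rule arg_cong)
    also have "\<dots> = third * (2 ^ j mod 3)" by (rule mult_mod_right[symmetric])
    finally show ?thesis by (simp only: two_pow_mod_3)
  qed
  show ?thesis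
  proof
    show "cyc_coset n third \<subseteq> {third, 2 * third}" by (auto simp: cyc_coset_def *)
    have "third * 2 ^ 0 mod n \<in> cyc_coset n third" "third * 2 ^ 1 mod n \<in> cyc_coset n third"
      unfolding cyc_coset_def by blast+
    thus "{third, 2 * third} \<subseteq> cyc_coset n third" unfolding * by (simp add: mult.commute)
  qed
qed

text \<open>If a coset avoided all residues of absolute value at most \<open>n / 6\<close>, then doubling would move
  its elements alternately into and out of the middle third of the circle; but \<open>m\<close> doublings,
  an odd number, amount to a negation, which preserves the middle third.\<close>
lemma leader_le_sixth:
  assumes "0 < x" and "x < n" and "x \<noteq> third" and "x \<noteq> 2 * third"
  obtains y where "y \<in> cyc_coset n x" and "0 < y" and "y \<le> sixth"
proof (rule ccontr)
  assume "\<not> thesis"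
  hence no: "sixth < y" if "y \<in> cyc_coset n x" for y
    using that cyc_coset_nonzero[OF that assms(1,2)] \<open>\<And>y. \<lbrakk>y \<in> cyc_coset n x; 0 < y; y \<le> sixth\<rbrakk> \<Longrightarrow> thesis\<close>
    by (meson not_le)
  define mid where "mid = (\<lambda>y. third < y \<and> y < 2 * third)"
  have flip: "mid (2 * y mod n) \<longleftrightarrow> \<not> mid y" if y: "y \<in> cyc_coset n x" for y
  proof -
    have lo: "sixth < y" using y by (rule no)
    have "sixth < n - y" using y lo by (intro no cyc_coset_neg) auto
    hence hi: "y + sixth < n" by simp
    \<comment> \<open>The end points of the middle third form a coset of their own, which does not
      contain \<open>x\<close>.\<close>
    have "y \<noteq> third \<and> y \<noteq> 2 * third"
    proof (rule ccontr)
      assume "\<not> ?thesis"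
      hence "y \<in> cyc_coset n third" by (auto simp: cyc_coset_third)
      hence "x \<in> cyc_coset n third" using cyc_coset_trans cyc_coset_sym[OF y assms(2)] by blast
      thus False using assms(3,4) by (simp add: cyc_coset_third)
    qed
    moreover have "2 * y mod n = (if 2 * y < n then 2 * y else 2 * y - n)"
      using hi by (simp add: mod_if)
    ultimately show ?thesis using lo hi n_third third_sixth unfolding mid_def by auto
  qed
  have alt: "mid (x * 2 ^ j mod n) \<longleftrightarrow> (mid x \<longleftrightarrow> even j)" for j
  proof (induction j)
    case 0
    show ?case using assms(2) by simp
  next
    case (Suc j)
    have "x * 2 ^ j mod n \<in> cyc_coset n x" unfolding cyc_coset_def by blast
    from flip[OF this] Suc show ?case by (simp add: mod_mult_right_eq mult_ac)
  qed
  have "x * 2 ^ m mod n = n - x"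
  proof -
    have "x * 2 ^ m + x = x * n" by (simp add: n_eq)
    hence "x * 2 ^ m = (n - x) + (x - 1) * n" using assms(1,2)
      by (cases x) (auto simp: algebra_simps)
    thus ?thesis by (simp only: mod_mult_self1) (use assms(1,2) in simp)
  qed
  moreover have "odd m" by (simp add: m_eq)
  ultimately have "mid (n - x) \<longleftrightarrow> \<not> mid x" using alt[of m] by simp
  thus False using n_third assms unfolding mid_def by auto
qed

text \<open>Here \<open>2 * (sixth - c) = third - s\<close> with \<open>s = 1 + 2 * c\<close>, and \<open>third * 2 ^ i\<close> only depends on
  the parity of \<open>i\<close> modulo \<open>n\<close>; hence only the last few powers of two need individual attention.\<close>
lemma large_leader_residue:
  assumes x: "x \<in> {sixth, sixth - 2, sixth - 8}" and j: "0 < j" "j < m"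
  shows "x < x * 2 ^ j mod n" and "x * 2 ^ j mod n < n - x"
proof -
  obtain u where q: "2 ^ (m - 7) = 3 * u + 1" and u5: "5 \<le> u" and n: "n = 384 * u + 129"
    and six: "sixth = 64 * u + 21" by (rule large_param)
  define X where "X = int x"
  define U where "U = int u"
  \<comment> \<open>One factor 2 is set aside to turn \<open>X\<close> into \<open>2 * X\<close>,
    which is \<open>third - s\<close>.\<close>
  define i where "i = j - 1"
  have ji: "j = Suc i" and im: "i \<le> m - 2" using j by (auto simp: i_def)
  have iq: "(2::int) ^ (m - 7) = 3 * U + 1"
    using arg_cong[OF q, of int] by (simp add: U_def)
  have U5: "5 \<le> U" using u5 by (simp add: U_def)
  have N: "int n = 384 * U + 129" by (simp add: n U_def)
  obtain s where s: "2 * X = 128 * U + 43 - s"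
    and cases_s: "s = 1 \<or> s = 5 \<or> s = 17"
    using x six u5 by (auto simp: X_def U_def of_nat_diff)
  define b :: int where "b = (if even i then 1 else 2)"
  obtain w where w: "2 ^ i = b + 3 * w" unfolding b_def by (rule two_pow_mod_3E)
  define E :: int where "E = 2 ^ i"
  define Y where "Y = (128 * U + 43) * b - s * E"
  have "X * 2 ^ j = (2 * X) * 2 ^ i" by (simp add: ji)
  also have "\<dots> = (128 * U + 43) * 2 ^ i - s * E" by (simp only: s left_diff_distrib E_def)
  also have "\<dots> = Y + int n * w" unfolding Y_def N by (simp only: w) (simp add: algebra_simps)
  finally have Y: "X * 2 ^ j = Y + int n * w" .
  \<comment> \<open>It suffices to name a multiple of \<open>n\<close> that brings \<open>Y\<close>
    into the window; this then is the residue.\<close>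
  have "\<exists>k. X < Y + int n * k \<and> Y + int n * k < int n - X"
  proof (cases "i \<le> m - 7")
    case True
    hence "(2::int) ^ i \<le> 2 ^ (m - 7)" by (intro power_increasing) auto
    hence le: "E \<le> 3 * U + 1" by (simp only: iq E_def)
    have ge: "1 \<le> E" by (simp add: E_def)
    have b: "b = 1 \<or> b = 2" by (simp add: b_def)
    \<comment> \<open>Here \<open>s * E\<close> is at most \<open>51 * U + 17\<close>, too small to
      push \<open>Y\<close> out of the window, so \<open>k = 0\<close> works.\<close>
    show ?thesis
      by (rule exI[of _ 0]) (use b cases_s s le ge U5 N in \<open>auto simp: Y_def\<close>)
  next
    case False
    then consider "i = m - 7 + 1" | "i = m - 7 + 2" | "i = m - 7 + 3" | "i = m - 7 + 4" | "i = m - 7 + 5"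
      using im m_eq t_ge by linarith
    moreover have ev: "even (m - 7)" using m_eq t_ge by simp
    ultimately have "b = 2 \<and> E = 6 * U + 2 \<or> b = 1 \<and> E = 12 * U + 4 \<or> b = 2 \<and> E = 24 * U + 8
      \<or> b = 1 \<and> E = 48 * U + 16 \<or> b = 2 \<and> E = 96 * U + 32"
      by cases (auto simp: b_def E_def power_add iq ev)
    then consider
        (1) "b = 2" "E = 6 * U + 2" | (2) "b = 1" "E = 12 * U + 4"
      | (3) "b = 2" "E = 24 * U + 8" | (4) "b = 1" "E = 48 * U + 16"
      | (5) "b = 2" "E = 96 * U + 32" by blast
    thus ?thesis
    proof cases
      case 1
      \<comment> \<open>In this and the following cases the three witnesses belong to
        \<open>s = 1\<close>, \<open>s = 5\<close> and \<open>s = 17\<close>; they count how many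
        times \<open>n\<close> has to be added to \<open>Y\<close>.\<close>
      from cases_s show ?thesis
        by (elim disjE) (rule exI[of _ 0], use s 1 U5 N in \<open>simp add: Y_def\<close>,
          rule exI[of _ 0], use s 1 U5 N in \<open>simp add: Y_def\<close>,
          rule exI[of _ 0], use s 1 U5 N in \<open>simp add: Y_def\<close>)
    next
      case 2
      from cases_s show ?thesis
        by (elim disjE) (rule exI[of _ 0], use s 2 U5 N in \<open>simp add: Y_def\<close>,
          rule exI[of _ 0], use s 2 U5 N in \<open>simp add: Y_def\<close>,
          rule exI[of _ 1], use s 2 U5 N in \<open>simp add: Y_def\<close>)
    next
      case 3
      from cases_s show ?thesis
        by (elim disjE) (rule exI[of _ 0], use s 3 U5 N in \<open>simp add: Y_def\<close>,
          rule exI[of _ 0], use s 3 U5 N in \<open>simp add: Y_def\<close>,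
          rule exI[of _ 1], use s 3 U5 N in \<open>simp add: Y_def\<close>)
    next
      case 4
      from cases_s show ?thesis
        by (elim disjE) (rule exI[of _ 0], use s 4 U5 N in \<open>simp add: Y_def\<close>,
          rule exI[of _ 1], use s 4 U5 N in \<open>simp add: Y_def\<close>,
          rule exI[of _ 2], use s 4 U5 N in \<open>simp add: Y_def\<close>)
    next
      case 5
      from cases_s show ?thesis
        by (elim disjE) (rule exI[of _ 0], use s 5 U5 N in \<open>simp add: Y_def\<close>,
          rule exI[of _ 1], use s 5 U5 N in \<open>simp add: Y_def\<close>,
          rule exI[of _ 4], use s 5 U5 N in \<open>simp add: Y_def\<close>)
    qed
  qed
  then obtain k where k: "X < Y + int n * k" "Y + int n * k < int n - X" by blast
  have "int (x * 2 ^ j mod n) = (X * 2 ^ j) mod int n" by (simp add: X_def zmod_int)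
  also have "X * 2 ^ j = (Y + int n * k) + int n * (w - k)" by (simp add: Y algebra_simps)
  also have "\<dots> mod int n = Y + int n * k"
    using k by (subst mod_mult_self2, intro mod_pos_pos_trivial) (auto simp: X_def)
  finally have res: "int (x * 2 ^ j mod n) = Y + int n * k" .
  show "x < x * 2 ^ j mod n" using k(1) res unfolding X_def by linarith
  show "x * 2 ^ j mod n < n - x" using k(2) res unfolding X_def by linarith
qed

text \<open>All residues \<open>x * 2 ^ j\<close> with \<open>0 < j < m\<close> lie strictly between
  \<open>x\<close> and \<open>n - x\<close>. Hence they differ from \<open>x\<close> and from its
  negative, and they and their negatives exceed \<open>x\<close>.\<close>

lemma large_leader:
  assumes x: "x \<in> {sixth, sixth - 2, sixth - 8}"
  shows "card (cyc_coset n x) = 2 * m" and "y \<in> cyc_coset n x \<Longrightarrow> x \<le> y"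
proof -
  have xn: "0 < x" "2 * x < n" using x sixth_ge n_third third_sixth by auto
  have split: "j = 0 \<and> (e = - 1 \<and> y = x \<or> e = 1 \<and> y = n - x) \<or> x < y \<and> y < n - x"
    if "j < m" "e = 1 \<or> e = - 1" "int n dvd int x * 2 ^ j + e * int y" "y < n" for j e y
  proof -
    define r where "r = x * 2 ^ j mod n"
    have "int n dvd int (x * 2 ^ j) - int r"
      unfolding r_def by (simp add: zmod_int minus_mod_eq_mult_div)
    from dvd_diff[OF that(3) this] have d: "int n dvd int r + e * int y" by (simp add: add.commute)
    have rn: "r < n" using xn by (simp add: r_def)
    \<comment> \<open>The alternative \<open>r = 0\<close> comes from the quotient 0 in
      \<open>r + y = n * k\<close>; it is impossible afterwards, as \<open>r\<close> is at least
      \<open>x\<close>.\<close>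
    have ry: "e = - 1 \<and> y = r \<or> e = 1 \<and> (y = n - r \<or> r = 0)"
      using that(2)
    proof
      assume "e = 1"
      hence "n dvd r + y" using d by (simp flip: of_nat_add)
      then obtain k where k: "r + y = n * k" by blast
      have "k < 2" using k rn that(4) by (metis add_less_mono mult_2_right mult_less_cancel1 mult.commute)
      hence "k = 0 \<or> k = 1" by auto
      thus ?thesis using k \<open>e = 1\<close> by auto
    next
      assume "e = - 1"
      hence "[int r = int y] (mod int n)" using d by (simp add: cong_iff_dvd_diff)
      hence "r = y" using rn that(4) by (simp add: cong_int_iff cong_def)
      thus ?thesis using \<open>e = - 1\<close> by simp
    qed
    show ?thesis
    proof (cases "j = 0")
      case True
      hence "r = x" using xn by (simp add: r_def)
      thus ?thesis using ry True xn by auto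
    next
      case False
      hence "x < r" "r < n - x" using large_leader_residue[OF x _ that(1)] by (auto simp: r_def)
      thus ?thesis using ry by auto
    qed
  qed
  show "card (cyc_coset n x) = 2 * m"
  proof (rule card_cyc_coset)
    show "x < n" using xn by simp
    fix j assume "j < m"
    show "j = 0" if "int n dvd int x * 2 ^ j - int x"
      using split[OF \<open>j < m\<close>, of "- 1" x] that xn by auto
    show "\<not> int n dvd int x * 2 ^ j + int x"
      using split[OF \<open>j < m\<close>, of 1 x] xn by auto
  qed
  show "x \<le> y" if y: "y \<in> cyc_coset n x"
  proof -
    obtain j e where "j < m" "e = 1 \<or> e = - 1" "int n dvd int x * 2 ^ j + e * int y"
      using mem_cyc_cosetE[OF y] by blast
    thus ?thesis using split[of j e y] mem_cyc_coset_less[OF y] xn by auto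
  qed
qed

section \<open>Defining sets for large designed distance\<close>

text \<open>For \<open>\<delta>\<close> between \<open>sixth - 9\<close> and \<open>n\<close> these
  are exactly the coset leaders not below \<open>\<delta>\<close>.\<close>

definition large_leaders :: "nat \<Rightarrow> nat set" where
  "large_leaders \<delta> = {x \<in> {third, sixth, sixth - 2, sixth - 8}. \<delta> \<le> x}"

lemma large_leaders_min:
  assumes "x \<in> large_leaders \<delta>" and "y \<in> cyc_coset n x"
  shows "x \<le> y"
proof (cases "x = third")
  case True
  thus ?thesis using assms(2) by (auto simp: cyc_coset_third)
next
  case False
  thus ?thesis using assms large_leader(2)[of x y] by (auto simp: large_leaders_def)
qed

text \<open>These are the two odd numbers from \<open>sixth - 8\<close> to \<open>sixth\<close> that
  are not leaders. Multiplied by \<open>2 ^ (m - 4) = 24 * u + 8\<close> and reduced by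
  \<open>(4 * u + 1) * n\<close>, they become \<open>20 * u + 7\<close> and
  \<open>-(28 * u + 9)\<close>.\<close>

lemma sixth_minus_4_6:
  assumes "x = sixth - 4 \<or> x = sixth - 6"
  obtains y where "y \<in> cyc_coset n x" and "0 < y" and "y < x"
proof -
  obtain u where q: "2 ^ (m - 7) = 3 * u + 1" and u5: "5 \<le> u" and n: "n = 384 * u + 129"
    and six: "sixth = 64 * u + 21" by (rule large_param)
  have "m - 4 = 3 + (m - 7)" using m_eq t_ge by simp
  hence "(2::nat) ^ (m - 4) = 2 ^ 3 * 2 ^ (m - 7)" by (metis power_add)
  hence p: "(2::nat) ^ (m - 4) = 24 * u + 8" by (simp add: q)
  have ip: "(2::int) ^ (m - 4) = 24 * int u + 8" using arg_cong[OF p, of int] by simp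
  from assms show ?thesis
  proof
    assume "x = sixth - 4"
    hence x: "x = 64 * u + 17" by (simp add: six)
    have "int x * 2 ^ (m - 4) - int (20 * u + 7) = int n * (4 * int u + 1)"
      unfolding ip x n by (simp add: algebra_simps)
    hence "20 * u + 7 \<in> cyc_coset n x" by (intro mem_cyc_cosetI[of _ _ "m - 4"]) (auto simp: n)
    thus ?thesis by (rule that) (auto simp: x)
  next
    assume "x = sixth - 6"
    hence x: "x = 64 * u + 15" by (simp add: six)
    have "int x * 2 ^ (m - 4) + int (28 * u + 9) = int n * (4 * int u + 1)"
      unfolding ip x n by (simp add: algebra_simps)
    hence "28 * u + 9 \<in> cyc_coset n x" by (intro mem_cyc_cosetI_neg[of _ _ "m - 4"]) (auto simp: n)
    thus ?thesis by (rule that) (auto simp: x)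
  qed
qed

lemma bch_zeros_large:
  assumes "sixth - 9 \<le> \<delta>" and "\<delta> \<le> n"
  shows "bch_zeros n \<delta> = {0<..<n} - (\<Union>x\<in>large_leaders \<delta>. cyc_coset n x)"
proof
  show "bch_zeros n \<delta> \<subseteq> {0<..<n} - (\<Union>x\<in>large_leaders \<delta>. cyc_coset n x)"
  proof
    fix y assume "y \<in> bch_zeros n \<delta>"
    then obtain x where x: "0 < x" "x < \<delta>" "y \<in> cyc_coset n x" by (auto simp: mem_bch_zeros_iff)
    have "y \<notin> cyc_coset n z" if z: "z \<in> large_leaders \<delta>" for z
    proof
      assume "y \<in> cyc_coset n z"
      moreover have "x \<in> cyc_coset n y" using x(3) by (rule cyc_coset_sym) (use x(2) assms(2) in simp)
      ultimately have "x \<in> cyc_coset n z" by (rule cyc_coset_trans)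
      hence "z \<le> x" by (rule large_leaders_min[OF z])
      thus False using z x(2) by (simp add: large_leaders_def)
    qed
    moreover have "0 < y" using cyc_coset_nonzero[OF x(3,1)] x(2) assms(2) by simp
    ultimately show "y \<in> {0<..<n} - (\<Union>x\<in>large_leaders \<delta>. cyc_coset n x)"
      using mem_cyc_coset_less[OF x(3)] by auto
  qed
  show "{0<..<n} - (\<Union>x\<in>large_leaders \<delta>. cyc_coset n x) \<subseteq> bch_zeros n \<delta>"
  proof (rule subsetI, rule ccontr)
    fix y assume y: "y \<in> {0<..<n} - (\<Union>x\<in>large_leaders \<delta>. cyc_coset n x)"
      and no: "y \<notin> bch_zeros n \<delta>"
    have yn: "0 < y" "y < n" using y by auto
    have not_large: "x \<notin> large_leaders \<delta>" if "x \<in> cyc_coset n y" for x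
      using y cyc_coset_sym[OF that yn(2)] by blast
    have ge: "\<delta> \<le> x" if "x \<in> cyc_coset n y" for x
    proof (rule ccontr)
      assume "\<not> \<delta> \<le> x"
      moreover have "0 < x" using that yn by (rule cyc_coset_nonzero)
      ultimately have "y \<in> bch_zeros n \<delta>"
        unfolding mem_bch_zeros_iff using cyc_coset_sym[OF that yn(2)] by (meson not_le)
      thus False using no by simp
    qed
    have "\<not> (y = third \<or> y = 2 * third)"
    proof
      assume "y = third \<or> y = 2 * third"
      hence "y \<in> cyc_coset n third" by (auto simp: cyc_coset_third)
      hence "third \<in> cyc_coset n y" by (rule cyc_coset_sym) (use n_third sixth_ge third_sixth in simp)
      thus False using not_large ge by (auto simp: large_leaders_def)
    qed
    then obtain x0 where x0: "x0 \<in> cyc_coset n y" "0 < x0" "x0 \<le> sixth"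
      using leader_le_sixth[OF yn] by blast
    \<comment> \<open>The least element of a coset outside the defining set is odd, at most
      \<open>sixth\<close> and at least \<open>sixth - 9\<close>. Of the five such numbers two are
      not leaders, and the others belong to \<open>large_leaders\<close> once they reach
      \<open>\<delta>\<close>.\<close>
    define x where "x = (LEAST x. x \<in> cyc_coset n y)"
    have x: "x \<in> cyc_coset n y" unfolding x_def using x0(1) by (rule LeastI)
    have least: "x \<le> z" if "z \<in> cyc_coset n y" for z unfolding x_def using that by (rule Least_le)
    have x_pos: "0 < x" using x yn by (rule cyc_coset_nonzero)
    have x_le: "x \<le> sixth" using least[OF x0(1)] x0(3) by simp
    have "odd x"
    proof
      assume "even x"
      hence "x div 2 \<in> cyc_coset n y" using x mem_cyc_coset_less[OF x] cyc_coset_half by blast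
      from least[OF this] show False using x_pos by simp
    qed
    moreover have "x \<noteq> sixth - 4 \<and> x \<noteq> sixth - 6"
    proof (rule ccontr)
      assume "\<not> ?thesis"
      then obtain z where "z \<in> cyc_coset n x" "z < x" using sixth_minus_4_6 by metis
      thus False using least cyc_coset_trans[OF x] by (meson not_le)
    qed
    moreover have "sixth - 9 \<le> x" using ge[OF x] assms(1) by simp
    ultimately have "x = sixth \<or> x = sixth - 2 \<or> x = sixth - 8"
      using x_le odd_sixth sixth_ge by presburger
    hence "x \<in> large_leaders \<delta>" using ge[OF x] by (auto simp: large_leaders_def)
    thus False using not_large[OF x] by simp
  qed
qed

lemma card_bch_zeros_large:
  assumes "sixth - 9 \<le> \<delta>" and "\<delta> \<le> n"
  shows "card (bch_zeros n \<delta>) = n - 1 - (\<Sum>x\<in>large_leaders \<delta>. if x = third then 2 else 2 * m)"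
proof -
  let ?U = "\<Union>x\<in>large_leaders \<delta>. cyc_coset n x"
  have lt: "0 < x \<and> x < n" if "x \<in> large_leaders \<delta>" for x
    using that sixth_ge third_sixth n_third by (auto simp: large_leaders_def)
  have sub: "?U \<subseteq> {0<..<n}"
    using cyc_coset_nonzero mem_cyc_coset_less lt by fastforce
  have "card ?U = (\<Sum>x\<in>large_leaders \<delta>. card (cyc_coset n x))"
  proof (rule card_UN_cyc_coset)
    show "finite (large_leaders \<delta>)" by (simp add: large_leaders_def)
    show "x < n" if "x \<in> large_leaders \<delta>" for x using lt[OF that] by simp
    show "x = y" if "x \<in> large_leaders \<delta>" "y \<in> large_leaders \<delta>" "y \<in> cyc_coset n x" for x y
      using large_leaders_min[OF that(1,3)] large_leaders_min[OF that(2) cyc_coset_sym[OF that(3)]] lt[OF that(1)]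
      by simp
  qed
  also have "\<dots> = (\<Sum>x\<in>large_leaders \<delta>. if x = third then 2 else 2 * m)"
  proof (rule sum.cong[OF refl])
    fix x assume "x \<in> large_leaders \<delta>"
    moreover have "card (cyc_coset n third) = 2"
      unfolding cyc_coset_third using third_sixth by simp
    ultimately show "card (cyc_coset n x) = (if x = third then 2 else 2 * m)"
      using large_leader(1)[of x] by (auto simp: large_leaders_def)
  qed
  finally have "card ?U = (\<Sum>x\<in>large_leaders \<delta>. if x = third then 2 else 2 * m)" .
  moreover have "card ({0<..<n} - ?U) = n - 1 - card ?U"
    using sub by (subst card_Diff_subset) (auto intro: finite_subset)
  ultimately show ?thesis by (simp add: bch_zeros_large[OF assms])
qed

text \<open>As the least element of its coset, \<open>third\<close> serves as the residue
  \<open>N\<close> that keeps the second code nontrivial.\<close>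

lemma third_notin_bch_zeros:
  assumes "\<delta> \<le> third"
  shows "third \<notin> bch_zeros n \<delta>"
proof
  assume "third \<in> bch_zeros n \<delta>"
  then obtain x where x: "0 < x" "x < \<delta>" "third \<in> cyc_coset n x" by (auto simp: mem_bch_zeros_iff)
  have "x \<in> cyc_coset n third" using x(3) by (rule cyc_coset_sym) (use x(2) assms n_third in simp)
  thus False using x(2) assms by (auto simp: cyc_coset_third)
qed

section \<open>Parameters in the individual ranges\<close>

lemma bch_params:
  fixes xi :: "'a::field"
  assumes "(2::'a) = 0" and "prim_root n xi"
    and "0 < \<delta>" and "\<delta> \<le> third" and "bch_zeros n \<delta> = bch_zeros n \<delta>'"
    and "0 < \<delta>'" and "\<delta>' \<le> third" and "card (bch_zeros n \<delta>) = z"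
  shows "code_dim (bch_code n xi \<delta> 1) (n - z) \<and> \<delta>' \<le> min_dist (bch_code n xi \<delta> 1)"
    and "code_dim (bch_code n xi (\<delta> + 1) 0) (2 ^ m - z) \<and>
      2 * \<delta>' \<le> min_dist (bch_code n xi (\<delta> + 1) 0)"
proof -
  have le: "\<delta> \<le> n" "\<delta>' \<le> n" "0 < third" "third < n"
    using assms(3,4,7) n_third by auto
  show "code_dim (bch_code n xi \<delta> 1) (n - z) \<and> \<delta>' \<le> min_dist (bch_code n xi \<delta> 1)"
    using bch_code_narrow_params[OF assms(1,2) le(1) assms(5,6) le(2) assms(8)] by simp
  show "code_dim (bch_code n xi (\<delta> + 1) 0) (2 ^ m - z) \<and>
      2 * \<delta>' \<le> min_dist (bch_code n xi (\<delta> + 1) 0)"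
    using bch_code_zero_params[OF assms(1-3) le(1) assms(5,6) le(2) assms(8)
        third_notin_bch_zeros[OF assms(4)] le(3,4)] by simp
qed

text \<open>This keeps the truncated subtractions in the following dimension count exact;
  \<open>6 * m + 3\<close> is the largest dimension there.\<close>

lemma m_small: "6 * m + 3 < n"
proof -
  have "t < 2 ^ t" by (rule less_exp)
  moreover define P :: nat where "P = 2 ^ t"
  ultimately have "t < P" "64 * P < n" "32 \<le> P" using n_large pow_t_ge by simp_all
  thus ?thesis using m_eq by linarith
qed

text \<open>If no large leader separates \<open>\<delta>\<close> from \<open>\<delta>'\<close>, both
  have the same zeros, so \<open>\<delta>'\<close> bounds the distance. The number \<open>i\<close>
  counts the remaining cosets of size \<open>2 * m\<close>; the 2 comes from the coset of
  \<open>third\<close>.\<close>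

lemma bch_params_large:
  fixes xi :: "'a::field"
  assumes "(2::'a) = 0" and "prim_root n xi"
    and "sixth - 9 \<le> \<delta>" and "\<delta> \<le> \<delta>'" and "\<delta>' \<le> third"
    and \<delta>: "large_leaders \<delta> = A" and \<delta>': "large_leaders \<delta>' = A"
    and "(\<Sum>x\<in>A. if x = third then 2 else 2 * m) = 2 * m * i + 2" and "i \<le> 3"
  shows "code_dim (bch_code n xi \<delta> 1) (2 * m * i + 3) \<and> \<delta>' \<le> min_dist (bch_code n xi \<delta> 1)"
    and "code_dim (bch_code n xi (\<delta> + 1) 0) (2 * m * i + 2) \<and>
      2 * \<delta>' \<le> min_dist (bch_code n xi (\<delta> + 1) 0)"
proof -
  have le: "0 < \<delta>" "\<delta> \<le> third" "0 < \<delta>'" "\<delta> \<le> n" "sixth - 9 \<le> \<delta>'" "\<delta>' \<le> n"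
    using assms(3-5) sixth_ge n_third by auto
  have eq: "bch_zeros n \<delta> = bch_zeros n \<delta>'"
    using bch_zeros_large[OF assms(3) le(4)] bch_zeros_large[OF le(5,6)] \<delta> \<delta>' by simp
  have "2 * m * i \<le> 6 * m" using assms(9) by (simp add: mult.commute)
  hence small: "2 * m * i + 3 < n" using m_small by linarith
  have card: "card (bch_zeros n \<delta>) = n - 1 - (2 * m * i + 2)"
    using card_bch_zeros_large[OF assms(3) le(4)] by (simp only: \<delta> assms(8))
  have "n - (n - 1 - (2 * m * i + 2)) = 2 * m * i + 3" using small by linarith
  moreover have "2 ^ m - (n - 1 - (2 * m * i + 2)) = 2 * m * i + 2" using small n_eq by linarith
  ultimately show "code_dim (bch_code n xi \<delta> 1) (2 * m * i + 3) \<and> \<delta>' \<le> min_dist (bch_code n xi \<delta> 1)"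
    and "code_dim (bch_code n xi (\<delta> + 1) 0) (2 * m * i + 2) \<and>
      2 * \<delta>' \<le> min_dist (bch_code n xi (\<delta> + 1) 0)"
    using bch_params[OF assms(1,2) le(1,2) eq le(3) assms(5) card] by simp_all
qed

text \<open>Only the residue 0 is missing from the defining set, which is the one for designed
  distance \<open>n\<close>; no word has larger weight than \<open>n\<close>.\<close>

lemma bch_params_trivial:
  fixes xi :: "'a::field"
  assumes "(2::'a) = 0" and "prim_root n xi" and "third < \<delta>" and "\<delta> \<le> n"
  shows "code_dim (bch_code n xi \<delta> 1) 1" and "min_dist (bch_code n xi \<delta> 1) = n"
proof -
  let ?C = "bch_code n xi \<delta> 1"
  have empty: "large_leaders \<delta> = {}" "large_leaders n = {}"
    using assms(3,4) third_sixth n_third by (auto simp: large_leaders_def)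
  have ge: "sixth - 9 \<le> \<delta>" "sixth - 9 \<le> n" "0 < n"
    using assms(3,4) third_sixth by auto
  have eq: "bch_zeros n \<delta> = bch_zeros n n"
    using bch_zeros_large[OF ge(1) assms(4)] bch_zeros_large[OF ge(2) order.refl] empty by simp
  have card: "card (bch_zeros n \<delta>) = n - 1"
    using card_bch_zeros_large[OF ge(1) assms(4)] by (simp add: empty)
  have "n - (n - 1) = 1" using ge(3) by simp
  with bch_code_narrow_params[OF assms(1,2,4) eq ge(3) order.refl card]
  have dim: "code_dim ?C 1" and dist: "n \<le> min_dist ?C" by simp_all
  show "code_dim ?C 1" by (rule dim)
  have sub: "?C \<subseteq> words n" unfolding bch_code_narrow cyclic_code_altdef by blast
  hence fin: "finite ?C" using finite_words finite_subset by blast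
  have "?C - {\<lambda>_. False} \<noteq> {}"
  proof
    assume "?C - {\<lambda>_. False} = {}"
    hence "card ?C \<le> card {\<lambda>_::nat. False}" by (intro card_mono) auto
    thus False using dim by (simp add: code_dim_def)
  qed
  then obtain c where c: "c \<in> ?C - {\<lambda>_. False}" by blast
  hence "min_dist ?C \<le> hweight c" unfolding min_dist_def using fin by (intro Min_le) auto
  also have "\<dots> \<le> card {..<n}" unfolding hweight_def
    by (rule card_mono) (use c sub in \<open>auto simp: words_def subset_iff not_le[symmetric]\<close>)
  finally show "min_dist ?C = n" using dist by simp
qed

end

theorem theorem3p7:
  fixes t m n \<delta> :: nat and dl :: "nat \<Rightarrow> nat" and \<xi> :: "'a::field"
  assumes hm: "m = 2 * t + 1" and hm11: "m \<ge> 11" and hn: "n = 2 ^ m + 1"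
    and hd1: "dl 1 = n div 3" and hd2: "dl 2 = (n - 3) div 6"
    and hd3: "dl 3 = dl 2 - 2" and hd4: "dl 4 = dl 2 - 8" and hd5: "dl 5 = dl 2 - 10"
    and hchar: "(2::'a) = 0" and hxi: "prim_root n \<xi>"
    and hodd: "odd \<delta>"
  shows
    "(let C = bch_code n \<xi> \<delta> 1 in
       (2 ^ (t + 1) + 3 \<le> \<delta> \<and> \<delta> \<le> 2 ^ (t + 1) + 2 ^ t - 3 \<longrightarrow>
          code_dim C (n + 5 * m - m * \<delta>) \<and> min_dist C \<ge> \<delta>) \<and>
       (2 ^ (t + 1) + 2 ^ t + 3 \<le> \<delta> \<and> \<delta> \<le> 2 ^ (t + 2) - 9 \<longrightarrow>
          code_dim C (n + 9 * m - m * \<delta>) \<and> min_dist C \<ge> \<delta>) \<and>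
       (2 ^ (t + 2) - 7 \<le> \<delta> \<and> \<delta> \<le> 2 ^ (t + 2) + 9 \<longrightarrow>
          code_dim C (n + 16 * m - 2 ^ (t + 2) * m) \<and> min_dist C \<ge> 2 ^ (t + 2) + 9) \<and>
       (\<forall>i\<in>{1..4}. dl (i + 1) + 2 \<le> \<delta> \<and> \<delta> \<le> dl i \<longrightarrow>
          code_dim C (2 * m * (i - 1) + 3) \<and> min_dist C \<ge> dl i) \<and>
       (dl 1 + 2 \<le> \<delta> \<and> \<delta> \<le> n \<longrightarrow> code_dim C 1 \<and> min_dist C = n))
     \<and>
     (let C = bch_code n \<xi> (\<delta> + 1) 0 in
       (2 ^ (t + 1) + 3 \<le> \<delta> \<and> \<delta> \<le> 2 ^ (t + 1) + 2 ^ t - 3 \<longrightarrow>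
          code_dim C (2 ^ m + 5 * m - m * \<delta>) \<and> min_dist C \<ge> 2 * \<delta>) \<and>
       (2 ^ (t + 1) + 2 ^ t + 3 \<le> \<delta> \<and> \<delta> \<le> 2 ^ (t + 2) - 9 \<longrightarrow>
          code_dim C (2 ^ m + 9 * m - m * \<delta>) \<and> min_dist C \<ge> 2 * \<delta>) \<and>
       (2 ^ (t + 2) - 7 \<le> \<delta> \<and> \<delta> \<le> 2 ^ (t + 2) + 9 \<longrightarrow>
          code_dim C (2 ^ m + 16 * m - 2 ^ (t + 2) * m) \<and> min_dist C \<ge> 2 * (2 ^ (t + 2) + 9)) \<and>
       (\<forall>i\<in>{1..4}. dl (i + 1) + 2 \<le> \<delta> \<and> \<delta> \<le> dl i \<longrightarrow>
          code_dim C (2 * m * (i - 1) + 2) \<and> min_dist C \<ge> 2 * dl i))"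
proof -
  interpret two_pow_plus_one_odd m n t
    using hm hm11 hn by unfold_locales auto
  define P :: nat where "P = 2 ^ t"
  have pow: "2 ^ (t + 1) = 2 * P" "2 ^ (t + 2) = 4 * P" "2 ^ t = P" by (simp_all add: P_def)
  have P: "32 \<le> P" "64 * P < n" using pow_t_ge n_large by (simp_all add: P_def)
  have dl1: "dl 1 = third" and dl2: "dl 2 = sixth" by (simp_all only: hd1 hd2 third_def sixth_def)
  have le_third: "4 * P + 9 \<le> third" using P n_third by linarith
  note params = bch_params[OF hchar hxi]
  have r1: "(code_dim (bch_code n \<xi> \<delta> 1) (n + 5 * m - m * \<delta>) \<and> \<delta> \<le> min_dist (bch_code n \<xi> \<delta> 1)) \<and>
      code_dim (bch_code n \<xi> (\<delta> + 1) 0) (2 ^ m + 5 * m - m * \<delta>) \<and>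
      2 * \<delta> \<le> min_dist (bch_code n \<xi> (\<delta> + 1) 0)"
    if a: "2 * P + 3 \<le> \<delta>" "\<delta> \<le> 2 * P + P - 3"
  proof -
    have card: "card (bch_zeros n \<delta>) = m * \<delta> - 5 * m"
      by (rule card_bch_zeros_range1) (use a hodd in \<open>simp_all add: pow\<close>)
    have "m * 5 \<le> m * \<delta>" using a P by (intro mult_left_mono) auto
    \<comment> \<open>The two truncated subtractions may be regrouped because
      \<open>5 * m \<le> m * \<delta>\<close>.\<close>
    hence "k - (m * \<delta> - 5 * m) = k + 5 * m - m * \<delta>" for k by linarith
    moreover have "0 < \<delta>" "\<delta> \<le> third" using a le_third P by auto
    ultimately show ?thesis using params[OF _ _ refl _ _ card] by simp
  qed
  have r2: "(code_dim (bch_code n \<xi> \<delta> 1) (n + 9 * m - m * \<delta>) \<and> \<delta> \<le> min_dist (bch_code n \<xi> \<delta> 1)) \<and>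
      code_dim (bch_code n \<xi> (\<delta> + 1) 0) (2 ^ m + 9 * m - m * \<delta>) \<and>
      2 * \<delta> \<le> min_dist (bch_code n \<xi> (\<delta> + 1) 0)"
    if a: "2 * P + P + 3 \<le> \<delta>" "\<delta> \<le> 4 * P - 9"
  proof -
    have card: "card (bch_zeros n \<delta>) = m * \<delta> - 9 * m"
      by (rule card_bch_zeros_range2) (use a hodd in \<open>simp_all add: pow\<close>)
    have "m * 9 \<le> m * \<delta>" using a P by (intro mult_left_mono) auto
    hence "k - (m * \<delta> - 9 * m) = k + 9 * m - m * \<delta>" for k by linarith
    moreover have "0 < \<delta>" "\<delta> \<le> third" using a le_third P by auto
    ultimately show ?thesis using params[OF _ _ refl _ _ card] by simp
  qed
  have r3: "(code_dim (bch_code n \<xi> \<delta> 1) (n + 16 * m - 4 * P * m) \<and>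
        4 * P + 9 \<le> min_dist (bch_code n \<xi> \<delta> 1)) \<and>
      code_dim (bch_code n \<xi> (\<delta> + 1) 0) (2 ^ m + 16 * m - 4 * P * m) \<and>
      2 * (4 * P + 9) \<le> min_dist (bch_code n \<xi> (\<delta> + 1) 0)"
    if a: "4 * P - 7 \<le> \<delta>" "\<delta> \<le> 4 * P + 9"
  proof -
    \<comment> \<open>The defining set is constant on this range: the upper end gives the distance,
      the lower end the size.\<close>
    have eq: "bch_zeros n \<delta> = bch_zeros n (4 * P + 9)" "bch_zeros n \<delta> = bch_zeros n (4 * P - 7)"
      using bch_zeros_range3[of \<delta>, unfolded pow] bch_zeros_range3[of "4 * P + 9", unfolded pow] a by simp_all
    have "4 * P - 7 = 2 * (2 * P - 4) + 1" using P(1) by linarith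
    hence "odd (4 * P - 7)" by simp
    hence "card (bch_zeros n \<delta>) = m * (4 * P - 7) - 9 * m"
      unfolding eq(2) by (intro card_bch_zeros_range2) (use P in \<open>auto simp: pow\<close>)
    also have "\<dots> = 4 * P * m - 16 * m" by (simp add: diff_mult_distrib2 mult_ac)
    finally have card: "card (bch_zeros n \<delta>) = 4 * P * m - 16 * m" .
    have "16 * m \<le> 4 * P * m" using P by (intro mult_right_mono) auto
    hence "k - (4 * P * m - 16 * m) = k + 16 * m - 4 * P * m" for k by linarith
    moreover have "0 < \<delta>" "\<delta> \<le> third" using a le_third P by auto
    ultimately show ?thesis using params[OF _ _ eq(1) _ le_third card] by simp
  qed
  have r4: "(code_dim (bch_code n \<xi> \<delta> 1) (2 * m * (i - 1) + 3) \<and> dl i \<le> min_dist (bch_code n \<xi> \<delta> 1)) \<and>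
      code_dim (bch_code n \<xi> (\<delta> + 1) 0) (2 * m * (i - 1) + 2) \<and>
      2 * dl i \<le> min_dist (bch_code n \<xi> (\<delta> + 1) 0)"
    if i: "i \<in> {1..4}" and a: "dl (i + 1) + 2 \<le> \<delta>" "\<delta> \<le> dl i" for i
  proof -
    \<comment> \<open>In each case the second designed distance is \<open>dl i\<close>, and
      \<open>i - 1\<close> cosets of full size remain besides that of \<open>third\<close>.\<close>
    note large = bch_params_large[OF hchar hxi]
    have dl: "dl 3 = sixth - 2" "dl 4 = sixth - 8" "dl 5 = sixth - 10" by (simp_all only: hd3 hd4 hd5 dl2)
    have ne: "third \<noteq> sixth" "third \<noteq> sixth - 2" "third \<noteq> sixth - 8"
      "sixth \<noteq> sixth - 2" "sixth \<noteq> sixth - 8" "sixth - 2 \<noteq> sixth - 8"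
      using third_sixth sixth_ge by linarith+
    consider "i = 1" | "i = 2" | "i = 3" | "i = 4" using i by fastforce
    thus ?thesis
    proof cases
      case 1
      hence b: "sixth + 2 \<le> \<delta>" "\<delta> \<le> third" using a dl1 dl2 by (simp_all add: numeral_2_eq_2)
      have lead: "large_leaders \<delta> = {third}" "large_leaders third = {third}"
        using b by (auto simp: large_leaders_def)
      show ?thesis unfolding 1 dl1 using large[OF _ b(2) order.refl lead, of 0] b by simp
    next
      case 2
      hence b: "sixth - 2 + 2 \<le> \<delta>" "\<delta> \<le> sixth" using a dl dl2 by simp_all
      have lead: "large_leaders \<delta> = {third, sixth}" "large_leaders sixth = {third, sixth}"
        using b third_sixth sixth_ge by (auto simp: large_leaders_def)
      have "sixth \<le> third" "sixth - 9 \<le> \<delta>" using third_sixth b by auto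
      thus ?thesis unfolding 2 dl2 using large[OF _ b(2) _ lead, of 1] ne by simp
    next
      case 3
      hence b: "sixth - 8 + 2 \<le> \<delta>" "\<delta> \<le> sixth - 2" using a dl by simp_all
      have lead: "large_leaders \<delta> = {third, sixth, sixth - 2}"
        "large_leaders (sixth - 2) = {third, sixth, sixth - 2}"
        using b third_sixth sixth_ge by (auto simp: large_leaders_def)
      have "sixth - 2 \<le> third" "sixth - 9 \<le> \<delta>" using third_sixth b by auto
      thus ?thesis unfolding 3 dl using large[OF _ b(2) _ lead, of 2] ne by simp
    next
      case 4
      hence b: "sixth - 10 + 2 \<le> \<delta>" "\<delta> \<le> sixth - 8" using a dl by simp_all
      have lead: "large_leaders \<delta> = {third, sixth, sixth - 2, sixth - 8}"
        "large_leaders (sixth - 8) = {third, sixth, sixth - 2, sixth - 8}"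
        using b third_sixth sixth_ge by (auto simp: large_leaders_def)
      have "sixth - 8 \<le> third" "sixth - 9 \<le> \<delta>" using third_sixth b by auto
      thus ?thesis unfolding 4 dl using large[OF _ b(2) _ lead, of 3] ne by simp
    qed
  qed
  have r5: "code_dim (bch_code n \<xi> \<delta> 1) 1 \<and> min_dist (bch_code n \<xi> \<delta> 1) = n"
    if "dl 1 + 2 \<le> \<delta>" "\<delta> \<le> n"
    using bch_params_trivial[OF hchar hxi] that dl1 by simp
  show ?thesis unfolding Let_def pow
    by (intro conjI impI ballI; (elim conjE)?) (use r1 r2 r3 r4 r5 in blast)+
qed

end
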